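(* Let $\ell\ge 1$ be an integer. The derivations $\theta_E,\varphi_1^B,\dots,\varphi_\ell^B$ form a basis of the $S$-module $D(\mathcal{S}(B_\ell))$; that is, they belong to $D(\mathcal{S}(B_\ell))$ and $D(\mathcal{S}(B_\ell))$ is a free $S$-module with basis $\theta_E,\varphi_1^B,\dots,\varphi_\ell^B$.
   Context: Let $S=\mathbb{R}[x_1,\dots,x_\ell,z]$ be the polynomial ring, with $x_1,\dots,x_\ell$ an orthonormal basis of the dual $E^*$ of an $\ell$-dimensional real Euclidean space $E$ and $z$ an additional coordinate. $\mathrm{Der}(S)$ is the $S$-module of $\mathbb{R}$-linear derivations $S\to S$; $\partial_i=\partial/\partial x_i$, $\partial_z=\partial/\partial z$. Positive roots of type $B_\ell$: $\Phi_+^B=\{x_i,\ x_p\pm x_q \mid 1\le i\le\ell,\ 1\le p<q\le\ell\}$. $\mathcal{S}(B_\ell)$ denotes the cone over the Shi arrangement of type $B_\ell$, i.e. the central arrangement in $\mathbb{R}^{\ell+1}$ defined by $z\prod_{\alpha\in\Phi_+^B}\alpha(\alpha-z)=0$. Its derivation module $D(\mathcal{S}(B_\ell))$ is the $S$-submodule of all $\theta\in\mathrm{Der}(S)$ such that $\theta(z)$ is divisible by $z$, and for every $\alpha\in\Phi_+^B$, $\theta(\alpha)$ is divisible by $\alpha$ and $\theta(\alpha-z)$ is divisible by $\alpha-z$. For integers $r\ge1$, $s\ge0$, $B_{r,s}^B(x)\in\mathbb{R}[x]$ is the unique polynomial with $B_{r,s}^B(0)=0$ and $$B_{r,s}^B(x+1)-B_{r,s}^B(x)=\frac{(x+1)^r-(-x)^r}{(x+1)-(-x)}(x+1)^s(-x)^s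 .$$ It has degree $\le r+2s$; its homogenization is the polynomial $\overline{B}_{r,s}^B(x,z):=z^{r+2s}B_{r,s}^B(x/z)$. For $1\le j\le\ell$ put $I_1^{(j)}=\{x_1,\dots,x_{j-1}\}$. Let $\sigma_k$ denote the elementary symmetric polynomial of degree $k$ ($\sigma_0=1$), and set $\sigma_k^{(2,j)}:=\sigma_k(x_j)$ (so $\sigma_0^{(2,j)}=1$, $\sigma_1^{(2,j)}=x_j$) and $\tau_k^{(3,j)}:=\sigma_k(x_{j+1}^2,\dots,x_\ell^2)$. The Euler derivation is $\theta_E:=z\partial_z+\sum_{i=1}^\ell x_i\partial_i$. For $1\le j\le\ell$ define $$\varphi_j^B:=(-1)^j\sum_{i=1}^\ell\Bigl\{\sum_{\substack{N_1,N_2\subset I_1^{(j)}\\N_1\cap N_2=\emptyset}}\Bigl(\prod_{x_t\in N_1}x_t^2\Bigr)\Bigl(\prod_{x_t\in N_2}(-x_tz)\Bigr)\sum_{\substack{0\le k_2\le1\\0\le k_3\le\ell-j}}(-1)^{k_2+k_3}\sigma_{k_2}^{(2,j)}\tau_{k_3}^{(3,j)}\,\overline{B}_{r,s}^B(x_i,z)\Bigr\}\partial_i,$$ where in each term $r:=2\ell-2j-k_2-2k_3+2\ge1$ and $s:=(j-1)-|N_1|-|N_2|\ge0$. *)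

theory Defs
  imports
    "HOL-Analysis.Analysis"
    "HOL-Library.Poly_Mapping"
    "HOL-Computational_Algebra.Polynomial"
begin

text \<open>Polynomials in the countably many variables \<open>Var 0, Var 1, \<dots>\<close>. The variable of index 0
  plays the role of \<open>z\<close>, and the variables of index \<open>1, \<dots>, l\<close> those of \<open>x\<^sub>1, \<dots>, x\<^sub>l\<close>.\<close>

type_synonym mpol = "(nat \<Rightarrow>\<^sub>0 nat) \<Rightarrow>\<^sub>0 real"

definition Cst :: "real \<Rightarrow> mpol" where
  "Cst c = Poly_Mapping.single 0 c"

definition Var :: "nat \<Rightarrow> mpol" where
  "Var i = Poly_Mapping.single (Poly_Mapping.single i 1) 1"

abbreviation Zv :: mpol where
  "Zv \<equiv> Var 0"

text \<open>The ring \<open>S = \<real>[x\<^sub>1, \<dots>, x\<^sub>l, z]\<close>.\<close>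

definition PolS :: "nat \<Rightarrow> mpol set" where
  "PolS l = {f. \<forall>m \<in> Poly_Mapping.keys f. Poly_Mapping.keys m \<subseteq> {0..l}}"

definition dvdS :: "nat \<Rightarrow> mpol \<Rightarrow> mpol \<Rightarrow> bool" where
  "dvdS l a b \<longleftrightarrow> (\<exists>q \<in> PolS l. b = a * q)"

text \<open>The partial derivative with respect to \<open>Var i\<close>. The subtraction of exponents is truncated
  only on monomials not containing \<open>Var i\<close>, and these get the coefficient 0.\<close>

definition pd :: "nat \<Rightarrow> mpol \<Rightarrow> mpol" where
  "pd i f = (\<Sum>m \<in> Poly_Mapping.keys f.
     Poly_Mapping.single (m - Poly_Mapping.single i 1)
       (real (Poly_Mapping.lookup m i) * Poly_Mapping.lookup f m))"

text \<open>Derivations of \<open>S\<close> are represented by functions on all of \<open>mpol\<close>; only their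
  values on \<open>PolS l\<close> are meaningful, and two derivations are equal if they agree on \<open>PolS l\<close>.\<close>

definition Der :: "nat \<Rightarrow> (mpol \<Rightarrow> mpol) set" where
  "Der l = {\<theta>. (\<forall>f \<in> PolS l. \<theta> f \<in> PolS l)
     \<and> (\<forall>f \<in> PolS l. \<forall>g \<in> PolS l. \<theta> (f + g) = \<theta> f + \<theta> g)
     \<and> (\<forall>c. \<forall>f \<in> PolS l. \<theta> (Cst c * f) = Cst c * \<theta> f)
     \<and> (\<forall>f \<in> PolS l. \<forall>g \<in> PolS l. \<theta> (f * g) = f * \<theta> g + g * \<theta> f)}"

definition pos_roots_B :: "nat \<Rightarrow> mpol set" where
  "pos_roots_B l = {Var i | i. 1 \<le> i \<and> i \<le> l}
     \<union> {Var p + Var q | p q. 1 \<le> p \<and> p < q \<and> q \<le> l}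
     \<union> {Var p - Var q | p q. 1 \<le> p \<and> p < q \<and> q \<le> l}"

definition D_Shi_B :: "nat \<Rightarrow> (mpol \<Rightarrow> mpol) set" where
  "D_Shi_B l = {\<theta> \<in> Der l. dvdS l Zv (\<theta> Zv)
     \<and> (\<forall>\<alpha> \<in> pos_roots_B l. dvdS l \<alpha> (\<theta> \<alpha>) \<and> dvdS l (\<alpha> - Zv) (\<theta> (\<alpha> - Zv)))}"

text \<open>The family \<open>b\<close> indexed by the finite set \<open>I\<close> is a basis of the \<open>S\<close>-module \<open>M\<close> of
  derivations.\<close>

definition is_basis :: "nat \<Rightarrow> 'i set \<Rightarrow> ('i \<Rightarrow> mpol \<Rightarrow> mpol) \<Rightarrow> (mpol \<Rightarrow> mpol) set \<Rightarrow> bool" where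
  "is_basis l I b M \<longleftrightarrow>
     (\<forall>k \<in> I. b k \<in> M)
     \<and> (\<forall>\<theta> \<in> M. \<exists>c. (\<forall>k \<in> I. c k \<in> PolS l) \<and> (\<forall>f \<in> PolS l. \<theta> f = (\<Sum>k\<in>I. c k * b k f)))
     \<and> (\<forall>c. (\<forall>k \<in> I. c k \<in> PolS l) \<and> (\<forall>f \<in> PolS l. (\<Sum>k\<in>I. c k * b k f) = 0) \<longrightarrow> (\<forall>k \<in> I. c k = 0))"

text \<open>The difference equation defining the polynomials \<open>B\<^sub>r\<^sub>,\<^sub>s\<close>. The linear polynomials
  \<open>[:1, 1:]\<close> and \<open>[:0, -1:]\<close> are \<open>x + 1\<close> and \<open>-x\<close>; the division by their difference is exact.\<close>

definition bern_rhs :: "nat \<Rightarrow> nat \<Rightarrow> real poly" where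
  "bern_rhs r s = (([:1, 1:] ^ r - [:0, -1:] ^ r) div ([:1, 1:] - [:0, -1:]))
     * [:1, 1:] ^ s * [:0, -1:] ^ s"

definition bern_B :: "nat \<Rightarrow> nat \<Rightarrow> real poly" where
  "bern_B r s = (THE B. poly B 0 = 0 \<and> pcompose B [:1, 1:] - B = bern_rhs r s)"

lemma difference_surj:
  fixes q :: "real poly"
  assumes "\<And>k. k \<ge> n \<Longrightarrow> coeff q k = 0"
  shows "\<exists>B. degree B \<le> n \<and> poly B 0 = 0 \<and> pcompose B [:1, 1:] - B = q"
  using assms
proof (induction n arbitrary: q)
  case 0
  then have "q = 0" by (intro poly_eqI) auto
  then show ?case by (intro exI[of _ 0]) auto
next
  case (Suc n)
  define a where "a = coeff q n / real (Suc n)"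
  define A :: "real poly" where "A = monom a (Suc n)"
  have pA: "pcompose A [:1, 1:] = smult a ([:1, 1:] ^ Suc n)"
    unfolding A_def poly_eq_poly_eq_iff[symmetric] fun_eq_iff
    by (simp add: poly_pcompose poly_monom del: power_Suc)
  have co: "coeff ([:1, 1:] ^ Suc n :: real poly) k = of_nat (Suc n choose k)" for k
  proof (cases "k \<le> Suc n")
    case True
    then show ?thesis by (subst coeff_linear_poly_power) auto
  next
    case False
    have "degree ([:1, 1:] ^ Suc n :: real poly) \<le> Suc n"
      using degree_power_le[of "[:1, 1:] :: real poly" "Suc n"] by simp
    with False have "degree ([:1, 1:] ^ Suc n :: real poly) < k" by simp
    with False show ?thesis by (simp add: coeff_eq_0 del: power_Suc)
  qed
  have "coeff (q - (pcompose A [:1, 1:] - A)) k = 0" if k: "k \<ge> n" for k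
  proof -
    consider "k = n" | "k = Suc n" | "k > Suc n" using k by linarith
    then show ?thesis
      using Suc.prems[of k]
      unfolding pA coeff_diff coeff_smult co
      by cases (auto simp: A_def a_def binomial_eq_0)
  qed
  from Suc.IH[OF this] obtain B where B: "degree B \<le> n" "poly B 0 = 0"
    "pcompose B [:1, 1:] - B = q - (pcompose A [:1, 1:] - A)" by blast
  show ?case
  proof (intro exI[of _ "B + A"] conjI)
    show "degree (B + A) \<le> Suc n"
      using B(1) degree_monom_le[of a "Suc n"] by (intro degree_add_le) (auto simp: A_def)
    show "poly (B + A) 0 = 0" using B(2) by (simp add: A_def poly_monom)
    show "pcompose (B + A) [:1, 1:] - (B + A) = q"
      using B(3) by (simp add: pcompose_add algebra_simps)
  qed
qed

lemma difference_unique: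
  fixes B B' :: "real poly"
  assumes "poly B 0 = 0" "poly B' 0 = 0"
    and "pcompose B [:1, 1:] - B = pcompose B' [:1, 1:] - B'"
  shows "B = B'"
proof (rule ccontr)
  assume ne: "B \<noteq> B'"
  define P where "P = B - B'"
  have step: "poly P (1 + x) = poly P x" for x
    using arg_cong[OF assms(3), of "\<lambda>p. poly p x"]
    by (simp add: P_def poly_pcompose algebra_simps)
  have "poly P (real n) = 0" for n
    by (induction n) (use assms step in \<open>auto simp: P_def\<close>)
  then have "range real \<subseteq> {x. poly P x = 0}" by auto
  moreover have "finite {x. poly P x = 0}"
    using ne by (intro poly_roots_finite) (simp add: P_def)
  ultimately have "finite (range real)" using finite_subset by blast
  then show False using finite_imageD[of real UNIV] by (simp add: inj_on_def)
qed

lemma bern_rhs_exact: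
  "([:1, 1:] - [:0, -1:]) * bern_rhs r s
     = ([:1, 1:] ^ r - [:0, -1:] ^ r) * [:1, 1:] ^ s * [:0, -1:] ^ s"
proof -
  have "([:1, 1:] - [:0, -1:] :: real poly) dvd [:1, 1:] ^ r - [:0, -1:] ^ r"
    unfolding power_diff_sumr2 by (rule dvd_triv_left)
  then show ?thesis
    unfolding bern_rhs_def mult.assoc[symmetric] by (simp only: dvd_mult_div_cancel)
qed

lemma bern_rhs_degree:
  assumes "r \<ge> 1" "k \<ge> r + 2 * s"
  shows "coeff (bern_rhs r s) k = 0"
proof (cases "bern_rhs r s = 0")
  case False
  have d1: "degree ([:1, 1:] ^ n :: real poly) \<le> n" for n
    using degree_power_le[of "[:1, 1:] :: real poly" n] by simp
  have d2: "degree ([:0, -1:] ^ n :: real poly) \<le> n" for n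
    using degree_power_le[of "[:0, -1:] :: real poly" n] by simp
  have "degree (([:1, 1:] - [:0, -1:]) * bern_rhs r s) \<le> r + s + s"
    unfolding bern_rhs_exact
    by (rule order.trans[OF degree_mult_le add_mono[OF order.trans[OF degree_mult_le
          add_mono[OF degree_diff_le[OF d1 d2] d1]] d2]])
  moreover have "degree (([:1, 1:] - [:0, -1:]) * bern_rhs r s) = 1 + degree (bern_rhs r s)"
    using False by (subst degree_mult_eq) auto
  ultimately have "degree (bern_rhs r s) < k" using assms by simp
  then show ?thesis by (rule coeff_eq_0)
qed simp

lemma bern_B:
  assumes "r \<ge> 1"
  shows "poly (bern_B r s) 0 = 0"
    and "pcompose (bern_B r s) [:1, 1:] - bern_B r s = bern_rhs r s"
    and "degree (bern_B r s) \<le> r + 2 * s"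
proof -
  obtain B where B: "degree B \<le> r + 2 * s" "poly B 0 = 0"
    "pcompose B [:1, 1:] - B = bern_rhs r s"
    using difference_surj[of "r + 2 * s" "bern_rhs r s", OF bern_rhs_degree[OF assms]] by auto
  have "bern_B r s = B"
    unfolding bern_B_def
  proof (rule the_equality)
    show "poly B 0 = 0 \<and> pcompose B [:1, 1:] - B = bern_rhs r s" using B by simp
  next
    fix C
    assume "poly C 0 = 0 \<and> pcompose C [:1, 1:] - C = bern_rhs r s"
    with B show "C = B" by (intro difference_unique[of C B]) simp_all
  qed
  with B show "poly (bern_B r s) 0 = 0"
    "pcompose (bern_B r s) [:1, 1:] - bern_B r s = bern_rhs r s"
    "degree (bern_B r s) \<le> r + 2 * s" by auto
qed

text \<open>The homogenization \<open>z\<^bsup>r+2s\<^esup> B\<^sub>r\<^sub>,\<^sub>s(x/z)\<close>, which is a polynomial as \<open>B\<^sub>r\<^sub>,\<^sub>s\<close> has degree at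
  most \<open>r + 2s\<close>.\<close>

definition bern_hom :: "nat \<Rightarrow> nat \<Rightarrow> mpol \<Rightarrow> mpol \<Rightarrow> mpol" where
  "bern_hom r s x z = (\<Sum>k\<le>r + 2 * s. Cst (coeff (bern_B r s) k) * x ^ k * z ^ (r + 2 * s - k))"

text \<open>The elementary symmetric polynomial of degree \<open>k\<close> in the family \<open>(f i)\<close> for \<open>i \<in> A\<close>.\<close>

definition esym :: "nat \<Rightarrow> (nat \<Rightarrow> mpol) \<Rightarrow> nat set \<Rightarrow> mpol" where
  "esym k f A = (\<Sum>K | K \<subseteq> A \<and> card K = k. \<Prod>i\<in>K. f i)"

definition theta_E :: "nat \<Rightarrow> mpol \<Rightarrow> mpol" where
  "theta_E l f = Zv * pd 0 f + (\<Sum>i=1..l. Var i * pd i f)"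

text \<open>The subsets \<open>N\<^sub>1, N\<^sub>2\<close> of \<open>{x\<^sub>1, \<dots>, x\<^sub>j\<^sub>-\<^sub>1}\<close> are represented by the sets of the indices of their
  elements. For \<open>1 \<le> j \<le> l\<close> no subtraction of natural numbers below is truncated.\<close>

definition phi_coeff :: "nat \<Rightarrow> nat \<Rightarrow> nat \<Rightarrow> mpol" where
  "phi_coeff l j i =
     (\<Sum>(N1, N2) | N1 \<subseteq> {1..<j} \<and> N2 \<subseteq> {1..<j} \<and> N1 \<inter> N2 = {}.
        (\<Prod>t\<in>N1. Var t ^ 2) * (\<Prod>t\<in>N2. - (Var t * Zv))
        * (\<Sum>k2\<in>{0..1}. \<Sum>k3\<in>{0..l - j}.
             (- 1) ^ (k2 + k3) * esym k2 Var {j} * esym k3 (\<lambda>t. Var t ^ 2) {j + 1..l}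
             * bern_hom (2 * l + 2 - 2 * j - k2 - 2 * k3) ((j - 1) - card N1 - card N2) (Var i) Zv))"

definition phi_B :: "nat \<Rightarrow> nat \<Rightarrow> mpol \<Rightarrow> mpol" where
  "phi_B l j f = (- 1) ^ j * (\<Sum>i=1..l. phi_coeff l j i * pd i f)"

end

theory Submission
  imports Defs "Jordan_Normal_Form.Determinant"
begin

unbundle no vec_syntax
hide_const (open) Determinants.det Module.smult

text \<open>
  Up to sign, \<open>phi_B l j\<close> kills \<open>z\<close> and sends \<open>x\<^sub>i\<close> to \<open>F\<^sub>j(x\<^sub>i)\<close> for a function \<open>F\<^sub>j\<close> (\<open>shi_fun\<close>) that does not depend on
  \<open>i\<close>. It is an odd polynomial function of degree at most \<open>2l\<close> with coefficients in \<open>S\<close>. Summing the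
  homogenized difference equations of the polynomials \<open>B\<^sub>r\<^sub>,\<^sub>s\<close> gives, with \<open>a = y + z\<close> and \<open>b = -y\<close>,
  \<open>(a - b) (F\<^sub>j(y + z) - F\<^sub>j(y)) = z P\<^sub>j(a, b)\<close> where
  \<open>P\<^sub>j(a, b) = \<Prod>\<^sub>t\<^sub><\<^sub>j (x\<^sub>t - a)(x\<^sub>t - b) \<cdot> (a (a - x\<^sub>j) \<Prod>\<^sub>t\<^sub>>\<^sub>j (a\<^sup>2 - x\<^sub>t\<^sup>2) - b (b - x\<^sub>j) \<Prod>\<^sub>t\<^sub>>\<^sub>j (b\<^sup>2 - x\<^sub>t\<^sup>2))\<close>
  (\<open>shi_fun_difference\<close>). Everything follows from this factorization.

  Membership: the linear forms other than \<open>z\<close> are \<open>x\<^sub>p - y\<close> and \<open>x\<^sub>p - (y + z)\<close> with \<open>y = 0\<close> or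
  \<open>y = \<plusminus>x\<^sub>q\<close>, \<open>p < q\<close>, and by oddness the derivation applied to them is \<open>F\<^sub>j(x\<^sub>p) - F\<^sub>j(y)\<close>. Divisibility by
  \<open>x\<^sub>p - y\<close> is clear, and modulo \<open>x\<^sub>p - (y + z)\<close> the factor \<open>P\<^sub>j\<close> of \<open>F\<^sub>j(y + z) - F\<^sub>j(y)\<close> vanishes
  (\<open>shi_vector_shi_fun\<close>).

  Independence: if \<open>H = \<Sum> c\<^sub>j F\<^sub>j\<close> vanishes at all \<open>x\<^sub>i\<close>, it has the \<open>2l + 1\<close> zeros \<open>0, \<plusminus>x\<^sub>i\<close>, so \<open>H = 0\<close> and
  \<open>\<Sum> c\<^sub>j P\<^sub>j = 0\<close>. For \<open>a = x\<^sub>k\<close> this system is triangular with nonzero diagonal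
  (\<open>shi_fun_independent\<close>).

  Spanning is Saito's criterion. A multiple of the Euler derivation makes the given derivation kill
  \<open>z\<close>. Each of the \<open>2l\<^sup>2\<close> linear forms divides every determinant whose columns are value vectors of such
  derivations, and they are pairwise coprime primes, so their product \<open>Q\<close> divides it
  (\<open>prod_shi_form_dvd_det\<close>). The determinant of \<open>(F\<^sub>j(x\<^sub>i))\<close> is homogeneous of degree \<open>2l\<^sup>2 = deg Q\<close> and
  nonzero by independence, so it is a nonzero constant multiple of \<open>Q\<close> (\<open>det_shi_matrix\<close>). Cramer's
  rule then expresses every such derivation with coefficients in \<open>S\<close> (\<open>shi_vector_spanned\<close>).
\<close>

section \<open>Polynomials in countably many variables\<close>

lemma Cst_0 [simp]: "Cst 0 = 0"
  and Cst_1 [simp]: "Cst 1 = 1"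
  and Cst_add: "Cst (a + b) = Cst a + Cst b"
  and Cst_mult: "Cst (a * b) = Cst a * Cst b"
  and Cst_uminus: "Cst (- a) = - Cst a"
  by (simp_all add: Cst_def single_add mult_single single_uminus)

lemma Cst_eq_0_iff [simp]: "Cst a = 0 \<longleftrightarrow> a = 0"
  by (metis Cst_def Cst_0 lookup_single_eq lookup_zero)

lemma mpol_sum_monomials:
  "(f :: mpol) = (\<Sum>m\<in>Poly_Mapping.keys f. Poly_Mapping.single m (Poly_Mapping.lookup f m))"
proof (rule poly_mapping_eqI)
  fix k
  have "Poly_Mapping.lookup (\<Sum>m\<in>Poly_Mapping.keys f. Poly_Mapping.single m (Poly_Mapping.lookup f m)) k
      = (\<Sum>m\<in>Poly_Mapping.keys f. if k = m then Poly_Mapping.lookup f m else 0)"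
    unfolding lookup_sum by (intro sum.cong) (auto simp: lookup_single when_def)
  also have "\<dots> = Poly_Mapping.lookup f k"
    by (simp add: in_keys_iff)
  finally show "Poly_Mapping.lookup f k = Poly_Mapping.lookup (\<Sum>m\<in>Poly_Mapping.keys f. Poly_Mapping.single m (Poly_Mapping.lookup f m)) k" ..
qed

lemma additive_mpol_eqI:
  fixes F G :: "mpol \<Rightarrow> 'a::ab_group_add"
  assumes "Modules.additive F" "Modules.additive G"
    and "\<And>m a. m \<in> Poly_Mapping.keys f \<Longrightarrow> F (Poly_Mapping.single m a) = G (Poly_Mapping.single m a)"
  shows "F f = G f"
proof -
  have "F f = (\<Sum>m\<in>Poly_Mapping.keys f. F (Poly_Mapping.single m (Poly_Mapping.lookup f m)))"
    by (subst mpol_sum_monomials) (rule Modules.additive.sum[OF assms(1)])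
  also have "\<dots> = (\<Sum>m\<in>Poly_Mapping.keys f. G (Poly_Mapping.single m (Poly_Mapping.lookup f m)))"
    using assms(3) by (intro sum.cong) auto
  also have "\<dots> = G f"
    by (subst (2) mpol_sum_monomials) (rule Modules.additive.sum[OF assms(2), symmetric])
  finally show ?thesis .
qed

lemma single_eq_Cst_prod:
  "Poly_Mapping.single m a = Cst a * (\<Prod>i\<in>Poly_Mapping.keys m. Var i ^ Poly_Mapping.lookup m i)"
proof -
  have pow: "Var i ^ n = Poly_Mapping.single (Poly_Mapping.single i n) 1" for i n
    by (induction n) (auto simp: Var_def mult_single simp flip: single_add)
  have prod: "(\<Prod>i\<in>A. Poly_Mapping.single (g i) 1) = (Poly_Mapping.single (\<Sum>i\<in>A. g i) 1 :: mpol)"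
    if "finite A" for A and g :: "nat \<Rightarrow> nat \<Rightarrow>\<^sub>0 nat"
    using that by induction (auto simp: mult_single)
  have m: "(\<Sum>i\<in>Poly_Mapping.keys m. Poly_Mapping.single i (Poly_Mapping.lookup m i)) = m"
  proof (rule poly_mapping_eqI)
    fix k
    have "Poly_Mapping.lookup (\<Sum>i\<in>Poly_Mapping.keys m. Poly_Mapping.single i (Poly_Mapping.lookup m i)) k
        = (\<Sum>i\<in>Poly_Mapping.keys m. if k = i then Poly_Mapping.lookup m i else 0)"
      unfolding lookup_sum by (intro sum.cong) (auto simp: lookup_single when_def)
    then show "Poly_Mapping.lookup (\<Sum>i\<in>Poly_Mapping.keys m. Poly_Mapping.single i (Poly_Mapping.lookup m i)) k = Poly_Mapping.lookup m k"
      by (simp add: in_keys_iff)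
  qed
  show ?thesis
    by (simp add: pow prod m Cst_def mult_single)
qed

lemma PolS_0 [simp]: "0 \<in> PolS l"
  and PolS_1 [simp]: "1 \<in> PolS l"
  and PolS_Cst [simp]: "Cst c \<in> PolS l"
  by (auto simp: PolS_def Cst_def)

lemma PolS_Var: "i \<le> l \<Longrightarrow> Var i \<in> PolS l"
  by (auto simp: PolS_def Var_def)

lemma PolS_add: "f \<in> PolS l \<Longrightarrow> g \<in> PolS l \<Longrightarrow> f + g \<in> PolS l"
  using Poly_Mapping.keys_add[of f g] by (fastforce simp: PolS_def)

lemma PolS_uminus: "f \<in> PolS l \<Longrightarrow> - f \<in> PolS l"
  by (auto simp: PolS_def in_keys_iff)

lemma PolS_diff: "f \<in> PolS l \<Longrightarrow> g \<in> PolS l \<Longrightarrow> f - g \<in> PolS l"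
  using PolS_add[OF _ PolS_uminus] by fastforce

lemma PolS_mult:
  assumes "f \<in> PolS l" "g \<in> PolS l"
  shows "f * g \<in> PolS l"
  unfolding PolS_def
proof safe
  fix m k assume m: "m \<in> Poly_Mapping.keys (f * g)" and k: "k \<in> Poly_Mapping.keys m"
  obtain a b where "a \<in> Poly_Mapping.keys f" "b \<in> Poly_Mapping.keys g" "m = a + b"
    using keys_mult[of f g] m by blast
  then show "k \<in> {0..l}"
    using assms k Poly_Mapping.keys_add[of a b] unfolding PolS_def by blast
qed

lemma PolS_power: "f \<in> PolS l \<Longrightarrow> f ^ n \<in> PolS l"
  by (induction n) (auto intro: PolS_mult)

lemma PolS_sum: "(\<And>i. i \<in> A \<Longrightarrow> f i \<in> PolS l) \<Longrightarrow> (\<Sum>i\<in>A. f i) \<in> PolS l"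
  by (induction A rule: infinite_finite_induct) (auto intro: PolS_add)

lemma PolS_prod: "(\<And>i. i \<in> A \<Longrightarrow> f i \<in> PolS l) \<Longrightarrow> (\<Prod>i\<in>A. f i) \<in> PolS l"
  by (induction A rule: infinite_finite_induct) (auto intro: PolS_mult)

lemmas PolS_intros =
  PolS_0 PolS_1 PolS_Cst PolS_Var PolS_add PolS_uminus PolS_diff PolS_mult PolS_power PolS_sum PolS_prod

lemma PolS_induct [consumes 1, case_names Cst Var add mult]:
  assumes "f \<in> PolS l"
    and "\<And>c. P (Cst c)"
    and "\<And>i. i \<le> l \<Longrightarrow> P (Var i)"
    and "\<And>f g. f \<in> PolS l \<Longrightarrow> g \<in> PolS l \<Longrightarrow> P f \<Longrightarrow> P g \<Longrightarrow> P (f + g)"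
    and "\<And>f g. f \<in> PolS l \<Longrightarrow> g \<in> PolS l \<Longrightarrow> P f \<Longrightarrow> P g \<Longrightarrow> P (f * g)"
  shows "P f"
proof -
  let ?Q = "\<lambda>f. f \<in> PolS l \<and> P f"
  have Q0: "?Q 0" and Q1: "?Q 1"
    using assms(2)[of 0] assms(2)[of 1] by auto
  have Qpow: "?Q (Var i ^ n)" if "i \<le> l" for i n
  proof (induction n)
    case (Suc n)
    then show ?case
      using assms(3)[OF that] assms(5)[OF PolS_Var[OF that], of "Var i ^ n"]
      by (auto intro: PolS_mult PolS_Var that)
  qed (use Q1 in simp)
  have Qprod: "?Q (\<Prod>i\<in>A. Var i ^ e i)" if "finite A" "A \<subseteq> {0..l}" for A and e :: "nat \<Rightarrow> nat"
    using that by (induction A) (use Q1 Qpow assms(5) in \<open>auto intro: PolS_mult\<close>)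
  have Qmon: "?Q (Poly_Mapping.single m a)" if "Poly_Mapping.keys m \<subseteq> {0..l}" for m a
    unfolding single_eq_Cst_prod using Qprod[of "Poly_Mapping.keys m" "Poly_Mapping.lookup m"] that assms(2,5)
    by (auto intro: PolS_mult)
  have Qsum: "?Q (\<Sum>m\<in>M. Poly_Mapping.single m (a m))"
    if "finite M" "\<forall>m\<in>M. Poly_Mapping.keys m \<subseteq> {0..l}" for M and a :: "_ \<Rightarrow> real"
    using that by (induction M) (use Q0 Qmon assms(4) in \<open>auto intro: PolS_add\<close>)
  show ?thesis
    using Qsum[of "Poly_Mapping.keys f" "Poly_Mapping.lookup f"] assms(1) mpol_sum_monomials[of f] by (simp add: PolS_def)
qed

lemma ex_PolS: "\<exists>l\<ge>n. f \<in> PolS l"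
proof (intro exI conjI)
  let ?V = "\<Union>m\<in>Poly_Mapping.keys f. Poly_Mapping.keys m"
  have "k \<le> Max (insert n ?V)" if "m \<in> Poly_Mapping.keys f" "k \<in> Poly_Mapping.keys m" for m k
    using that by (intro Max_ge) auto
  then show "f \<in> PolS (Max (insert n ?V))"
    by (auto simp: PolS_def)
  show "n \<le> Max (insert n ?V)" by (intro Max_ge) auto
qed


section \<open>Substitution homomorphisms and divisibility by linear forms\<close>

text \<open>The image of a polynomial under the substitution of \<open>\<sigma> i\<close> for \<open>Var i\<close>.\<close>

definition subst_var :: "(nat \<Rightarrow> mpol) \<Rightarrow> mpol \<Rightarrow> mpol" where
  "subst_var \<sigma> f = (\<Sum>m\<in>Poly_Mapping.keys f. Cst (Poly_Mapping.lookup f m) * (\<Prod>i\<in>Poly_Mapping.keys m. \<sigma> i ^ Poly_Mapping.lookup m i))"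

lemma subst_var_single:
  "subst_var \<sigma> (Poly_Mapping.single m a) = Cst a * (\<Prod>i\<in>Poly_Mapping.keys m. \<sigma> i ^ Poly_Mapping.lookup m i)"
  by (cases "a = 0") (auto simp: subst_var_def)

lemma subst_var_Cst [simp]: "subst_var \<sigma> (Cst c) = Cst c"
  and subst_var_Var [simp]: "subst_var \<sigma> (Var i) = \<sigma> i"
  by (simp_all add: subst_var_single Cst_def[of c] Var_def)

lemma subst_var_0 [simp]: "subst_var \<sigma> 0 = 0"
  and subst_var_1 [simp]: "subst_var \<sigma> 1 = 1"
  using subst_var_Cst[of \<sigma> 0] subst_var_Cst[of \<sigma> 1] by simp_all

lemma subst_var_add: "subst_var \<sigma> (f + g) = subst_var \<sigma> f + subst_var \<sigma> g"
  unfolding subst_var_def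
  by (rule setsum_keys_plus_distrib) (simp_all add: Cst_add algebra_simps)

lemma additive_subst_var: "Modules.additive (subst_var \<sigma>)"
  by unfold_locales (rule subst_var_add)

lemma subst_var_mult: "subst_var \<sigma> (f * g) = subst_var \<sigma> f * subst_var \<sigma> g"
proof -
  have prod: "(\<Prod>i\<in>Poly_Mapping.keys m. \<sigma> i ^ Poly_Mapping.lookup m i) = (\<Prod>i\<in>A. \<sigma> i ^ Poly_Mapping.lookup m i)"
    if "finite A" "Poly_Mapping.keys m \<subseteq> A" for m A
    using that by (intro prod.mono_neutral_left) (auto simp: in_keys_iff)
  have exps: "(\<Prod>i\<in>Poly_Mapping.keys (m + n). \<sigma> i ^ Poly_Mapping.lookup (m + n) i)
      = (\<Prod>i\<in>Poly_Mapping.keys m. \<sigma> i ^ Poly_Mapping.lookup m i) * (\<Prod>i\<in>Poly_Mapping.keys n. \<sigma> i ^ Poly_Mapping.lookup n i)" for m n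
    using Poly_Mapping.keys_add[of m n]
    by (subst (1 2 3) prod[of "Poly_Mapping.keys m \<union> Poly_Mapping.keys n"])
      (auto simp: lookup_add power_add prod.distrib)
  show ?thesis
  proof (rule additive_mpol_eqI[of "\<lambda>f. subst_var \<sigma> (f * g)" "\<lambda>f. subst_var \<sigma> f * subst_var \<sigma> g"])
    fix m a
    show "subst_var \<sigma> (Poly_Mapping.single m a * g) = subst_var \<sigma> (Poly_Mapping.single m a) * subst_var \<sigma> g"
      by (rule additive_mpol_eqI[of "\<lambda>g. subst_var \<sigma> (Poly_Mapping.single m a * g)"
            "\<lambda>g. subst_var \<sigma> (Poly_Mapping.single m a) * subst_var \<sigma> g"])
        (auto simp: Modules.additive_def subst_var_add distrib_left mult_single subst_var_single exps Cst_mult)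
  qed (auto simp: Modules.additive_def subst_var_add distrib_right)
qed

lemma subst_var_uminus: "subst_var \<sigma> (- f) = - subst_var \<sigma> f"
  and subst_var_diff: "subst_var \<sigma> (f - g) = subst_var \<sigma> f - subst_var \<sigma> g"
  and subst_var_sum: "subst_var \<sigma> (sum h A) = (\<Sum>i\<in>A. subst_var \<sigma> (h i))"
  by (rule additive_subst_var[THEN Modules.additive.minus] additive_subst_var[THEN Modules.additive.diff]
      additive_subst_var[THEN Modules.additive.sum])+

lemma subst_var_power: "subst_var \<sigma> (f ^ n) = subst_var \<sigma> f ^ n"
  by (induction n) (auto simp: subst_var_mult)

lemma subst_var_prod: "subst_var \<sigma> (prod h A) = (\<Prod>i\<in>A. subst_var \<sigma> (h i))"
  by (induction A rule: infinite_finite_induct) (auto simp: subst_var_mult)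

lemmas subst_var_simps = subst_var_add subst_var_mult subst_var_uminus subst_var_diff
  subst_var_sum subst_var_power subst_var_prod

lemma comm_ring_hom_subst_var: "comm_ring_hom (subst_var \<sigma>)"
  by unfold_locales (auto simp: subst_var_add subst_var_mult)

lemma subst_var_id:
  assumes "f \<in> PolS l" "\<And>i. i \<le> l \<Longrightarrow> \<sigma> i = Var i"
  shows "subst_var \<sigma> f = f"
  using assms(1) by (induction rule: PolS_induct) (auto simp: assms(2) subst_var_simps)

lemma subst_var_in_PolS:
  assumes "\<And>i. \<sigma> i \<in> PolS l"
  shows "subst_var \<sigma> f \<in> PolS l"
  unfolding subst_var_def using assms by (intro PolS_intros)

text \<open>Setting the variables outside \<open>PolS l\<close> to 0 in the quotient shows that divisibility in
  \<open>PolS l\<close> is divisibility in the ring of all polynomials.\<close>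

lemma dvdS_iff_dvd:
  assumes "a \<in> PolS l" "b \<in> PolS l"
  shows "dvdS l a b \<longleftrightarrow> a dvd b"
proof
  assume "a dvd b"
  then obtain q where q: "b = a * q" ..
  let ?\<sigma> = "\<lambda>i. if i \<le> l then Var i else 0"
  have "subst_var ?\<sigma> b = subst_var ?\<sigma> a * subst_var ?\<sigma> q"
    unfolding q subst_var_mult ..
  moreover have "subst_var ?\<sigma> a = a" "subst_var ?\<sigma> b = b"
    using assms by (auto intro: subst_var_id)
  moreover have "subst_var ?\<sigma> q \<in> PolS l"
    by (intro subst_var_in_PolS) (auto intro: PolS_Var)
  ultimately show "dvdS l a b" unfolding dvdS_def by auto
qed (auto simp: dvdS_def)

lemma subst_one_var_congruent:
  "Var p - \<beta> dvd f - subst_var (Var(p := \<beta>)) f"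
proof -
  obtain l where "f \<in> PolS l" using ex_PolS by blast
  then show ?thesis
  proof (induction rule: PolS_induct)
    case (mult f g)
    let ?s = "subst_var (Var(p := \<beta>))"
    have "f * g - ?s (f * g) = f * (g - ?s g) + (f - ?s f) * ?s g"
      by (simp add: subst_var_mult algebra_simps)
    then show ?case using mult by (metis dvd_add dvd_mult dvd_mult2)
  next
    case (add f g)
    then show ?case by (simp add: subst_var_add add_diff_add dvd_add)
  qed auto
qed

text \<open>Linear forms of the shape \<open>Var p - \<beta>\<close> with \<open>\<beta>\<close> free of \<open>Var p\<close> are prime, as divisibility
  by such a form means vanishing after substitution of \<open>\<beta>\<close> for \<open>Var p\<close>.\<close>

lemma linear_dvd_iff_subst_zero:
  assumes "subst_var (Var(p := \<beta>)) \<beta> = \<beta>"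
  shows "Var p - \<beta> dvd f \<longleftrightarrow> subst_var (Var(p := \<beta>)) f = 0"
proof
  assume "Var p - \<beta> dvd f"
  then show "subst_var (Var(p := \<beta>)) f = 0"
    using assms by (auto simp: subst_var_mult subst_var_diff)
next
  assume "subst_var (Var(p := \<beta>)) f = 0"
  then show "Var p - \<beta> dvd f"
    using subst_one_var_congruent[of p \<beta> f] by simp
qed

text \<open>The coefficient of the degree one monomial \<open>Var i\<close>.\<close>

definition lin_coeff :: "nat \<Rightarrow> mpol \<Rightarrow> real" where
  "lin_coeff i f = Poly_Mapping.lookup f (Poly_Mapping.single i 1)"

lemma lin_coeff_simps [simp]:
  "lin_coeff i 0 = 0"
  "lin_coeff i (f + g) = lin_coeff i f + lin_coeff i g"
  "lin_coeff i (f - g) = lin_coeff i f - lin_coeff i g"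
  "lin_coeff i (- f) = - lin_coeff i f"
  "lin_coeff i (Var k) = (if i = k then 1 else 0)"
proof -
  have "Poly_Mapping.single i (1::nat) = Poly_Mapping.single k 1 \<longleftrightarrow> i = k"
    by (metis lookup_single_eq lookup_single_not_eq one_neq_zero)
  then show "lin_coeff i (Var k) = (if i = k then 1 else 0)"
    by (auto simp: lin_coeff_def Var_def lookup_single when_def)
qed (simp_all add: lin_coeff_def lookup_add lookup_minus)

lemma nonzero_if_lin_coeff: "lin_coeff i f \<noteq> 0 \<Longrightarrow> f \<noteq> 0"
  by auto

section \<open>Homogenized difference equations\<close>

text \<open>The homogenization \<open>z\<^sup>n p(x/z)\<close> of a polynomial \<open>p\<close> of degree at most \<open>n\<close>. It is linear in
  \<open>p\<close>, multiplicative in \<open>(n, p)\<close>, and turns the shift \<open>x \<mapsto> x + 1\<close> into \<open>x \<mapsto> x + z\<close>.\<close>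

definition homogenize :: "nat \<Rightarrow> real poly \<Rightarrow> mpol \<Rightarrow> mpol \<Rightarrow> mpol" where
  "homogenize n p x z = (\<Sum>k\<le>n. Cst (coeff p k) * x ^ k * z ^ (n - k))"

lemma bern_hom_eq_homogenize: "bern_hom r s = homogenize (r + 2 * s) (bern_B r s)"
  by (simp add: bern_hom_def homogenize_def fun_eq_iff)

lemma homogenize_zero [simp]: "homogenize n 0 x z = 0"
  by (simp add: homogenize_def)

lemma homogenize_add: "homogenize n (p + q) x z = homogenize n p x z + homogenize n q x z"
  by (simp add: homogenize_def Cst_add algebra_simps sum.distrib)

lemma homogenize_uminus: "homogenize n (- p) x z = - homogenize n p x z"
  by (simp add: homogenize_def Cst_uminus sum_negf)

lemma homogenize_diff: "homogenize n (p - q) x z = homogenize n p x z - homogenize n q x z"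
  using homogenize_add[of n p "- q"] by (simp add: homogenize_uminus)

lemma homogenize_smult: "homogenize n (smult c p) x z = Cst c * homogenize n p x z"
  by (simp add: homogenize_def Cst_mult algebra_simps sum_distrib_left)

lemma homogenize_pCons:
  "homogenize (Suc n) (pCons a p) x z = Cst a * z ^ Suc n + x * homogenize n p x z"
  unfolding homogenize_def
  by (subst sum.atMost_Suc_shift) (simp add: sum_distrib_left algebra_simps)

lemma homogenize_0: "homogenize 0 p x z = Cst (coeff p 0)"
  by (simp add: homogenize_def)

lemma homogenize_raise_degree:
  assumes "degree p \<le> n"
  shows "homogenize (d + n) p x z = z ^ d * homogenize n p x z"
proof -
  have "homogenize (d + n) p x z = (\<Sum>k\<le>n. Cst (coeff p k) * x ^ k * z ^ (d + n - k))"
    unfolding homogenize_def using assms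
    by (intro sum.mono_neutral_right) (auto simp: coeff_eq_0)
  also have "\<dots> = z ^ d * homogenize n p x z"
    unfolding homogenize_def sum_distrib_left
    by (intro sum.cong) (simp_all add: mult.left_commute flip: power_add)
  finally show ?thesis .
qed

lemma homogenize_mult:
  assumes "degree p \<le> m" "degree q \<le> n"
  shows "homogenize (m + n) (p * q) x z = homogenize m p x z * homogenize n q x z"
  using assms(1)
proof (induction m arbitrary: p)
  case 0
  then obtain a where "p = [:a:]" by (metis degree_eq_zeroE le_zero_eq)
  then show ?case by (simp add: homogenize_smult homogenize_0)
next
  case (Suc m)
  obtain a p' where p: "p = pCons a p'" by (cases p)
  then have p': "degree p' \<le> m" using Suc.prems by (cases "p' = 0") auto
  have "homogenize (Suc m + n) (p * q) x z
      = Cst a * homogenize (Suc m + n) q x z + homogenize (Suc (m + n)) (pCons 0 (p' * q)) x z"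
    by (simp add: p homogenize_add homogenize_smult)
  also have "\<dots> = Cst a * (z ^ Suc m * homogenize n q x z)
      + x * (homogenize m p' x z * homogenize n q x z)"
    unfolding homogenize_raise_degree[OF assms(2)] homogenize_pCons Suc.IH[OF p'] by simp
  also have "\<dots> = homogenize (Suc m) p x z * homogenize n q x z"
    by (simp add: p homogenize_pCons algebra_simps)
  finally show ?case .
qed

lemma homogenize_shift:
  assumes "degree p \<le> n"
  shows "homogenize n (pcompose p [:1, 1:]) x z = homogenize n p (x + z) z"
  using assms
proof (induction n arbitrary: p)
  case 0
  then obtain a where "p = [:a:]" by (metis degree_eq_zeroE le_zero_eq)
  then show ?case by (simp add: homogenize_0 pcompose_const)
next
  case (Suc n)
  obtain a p' where p: "p = pCons a p'" by (cases p)
  then have p': "degree p' \<le> n" using Suc.prems by (cases "p' = 0") auto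
  have "homogenize (1 + n) ([:1, 1:] * pcompose p' [:1, 1:]) x z
      = homogenize 1 [:1, 1:] x z * homogenize n p' (x + z) z"
    unfolding Suc.IH[OF p', symmetric] using p' by (intro homogenize_mult) (auto simp: degree_pcompose)
  moreover have "homogenize 1 [:1, 1:] x z = x + z"
    by (simp add: homogenize_def)
  moreover have "homogenize (Suc n) [:a:] x z = Cst a * z ^ Suc n"
    by (simp add: homogenize_pCons)
  ultimately show ?case
    by (simp add: p pcompose_pCons homogenize_add homogenize_pCons del: mult_pCons_left)
qed

lemma homogenize_power:
  assumes "degree p \<le> 1"
  shows "homogenize n (p ^ n) x z = homogenize 1 p x z ^ n"
proof (induction n)
  case (Suc n)
  have "degree (p ^ n) \<le> n"
    using order.trans[OF degree_power_le mult_le_mono1[OF assms]] by simp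
  then have "homogenize (1 + n) (p * p ^ n) x z = homogenize 1 p x z * homogenize n (p ^ n) x z"
    using assms by (intro homogenize_mult)
  then show ?case using Suc by simp
qed (simp add: homogenize_0)

text \<open>The defining equation of \<open>B\<^sub>r\<^sub>,\<^sub>s\<close> after homogenization and multiplication by the denominator,
  with \<open>a = y + z\<close> and \<open>b = -y\<close>, so that \<open>a - b = 2y + z\<close>.\<close>

lemma bern_hom_difference:
  assumes "r \<ge> 1"
  shows "(y + z - (- y)) * (bern_hom r s (y + z) z - bern_hom r s y z)
    = z * ((y + z) ^ r - (- y) ^ r) * ((y + z) * (- y)) ^ s"
proof -
  let ?n = "r + 2 * s" and ?a = "[:1, 1:] :: real poly" and ?b = "[:0, -1:] :: real poly"
  note B = bern_B[OF assms, of s]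
  have a: "homogenize n (?a ^ n) y z = (y + z) ^ n" for n
    by (simp add: homogenize_power) (simp add: homogenize_def add.commute)
  have b: "homogenize n (?b ^ n) y z = (- y) ^ n" for n
    by (simp add: homogenize_power) (simp add: homogenize_def Cst_uminus)
  have da: "degree (?a ^ n) \<le> n" for n
    using degree_power_le[of ?a n] by simp
  have db: "degree (?b ^ n) \<le> n" for n
    using degree_power_le[of ?b n] by simp
  have dB: "degree (pcompose (bern_B r s) ?a - bern_B r s) \<le> ?n"
    using B(3) by (intro degree_diff_le) (auto simp: degree_pcompose)
  have "homogenize (1 + ?n) ((?a - ?b) * (pcompose (bern_B r s) ?a - bern_B r s)) y z
      = homogenize 1 (?a - ?b) y z * homogenize ?n (pcompose (bern_B r s) ?a - bern_B r s) y z"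
    using dB by (intro homogenize_mult) auto
  also have "homogenize 1 (?a - ?b) y z = y + z - (- y)"
    unfolding homogenize_diff using a[of 1] b[of 1] by simp
  also have "homogenize ?n (pcompose (bern_B r s) ?a - bern_B r s) y z
      = bern_hom r s (y + z) z - bern_hom r s y z"
    unfolding homogenize_diff homogenize_shift[OF B(3)] bern_hom_eq_homogenize ..
  finally have 1: "homogenize (1 + ?n) ((?a - ?b) * bern_rhs r s) y z
      = (y + z - (- y)) * (bern_hom r s (y + z) z - bern_hom r s y z)"
    unfolding B(2) .
  have d1: "degree (?a ^ r - ?b ^ r) \<le> r"
    by (intro degree_diff_le da db)
  have d2: "degree ((?a ^ r - ?b ^ r) * ?a ^ s) \<le> r + s"
    by (rule order.trans[OF degree_mult_le add_mono[OF d1 da]])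
  have d3: "degree ((?a ^ r - ?b ^ r) * ?a ^ s * ?b ^ s) \<le> r + s + s"
    by (rule order.trans[OF degree_mult_le add_mono[OF d2 db]])
  have "homogenize (1 + ?n) ((?a - ?b) * bern_rhs r s) y z
      = z * homogenize (r + s + s) ((?a ^ r - ?b ^ r) * ?a ^ s * ?b ^ s) y z"
    unfolding bern_rhs_exact using homogenize_raise_degree[OF d3, of 1 y z]
    by (simp only: mult_2 add.assoc power_one_right)
  also have "\<dots> = z * (homogenize r (?a ^ r - ?b ^ r) y z * (y + z) ^ s * (- y) ^ s)"
    unfolding homogenize_mult[OF d2 db] homogenize_mult[OF d1 da] a b ..
  also have "\<dots> = z * ((y + z) ^ r - (- y) ^ r) * ((y + z) * (- y)) ^ s"
    unfolding homogenize_diff a b by (simp only: power_mult_distrib mult.assoc)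
  finally show ?thesis unfolding 1 .
qed

text \<open>The right-hand side of the difference equation is invariant under \<open>x \<mapsto> -1 - x\<close>, which
  exchanges \<open>x + 1\<close> and \<open>-x\<close>. Therefore \<open>-B\<^sub>r\<^sub>,\<^sub>s(-x)\<close> solves it as well.\<close>

lemma bern_B_odd:
  assumes "r \<ge> 1"
  shows "pcompose (bern_B r s) [:0, -1:] = - bern_B r s"
proof -
  let ?a = "[:1, 1:] :: real poly" and ?b = "[:0, -1:] :: real poly" and ?c = "[:-1, -1:] :: real poly"
  let ?C = "- pcompose (bern_B r s) ?b"
  note B = bern_B[OF assms, of s]
  have sym: "pcompose (bern_rhs r s) ?c = bern_rhs r s"
  proof -
    define a b where "a = ?a" and "b = ?b"
    have ca: "pcompose a ?c = b" and cb: "pcompose b ?c = a" and ne: "b - a \<noteq> 0"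
      by (simp_all add: a_def b_def pcompose_pCons)
    have pow: "pcompose (p ^ n) q = pcompose p q ^ n" for p q :: "real poly" and n
      by (induction n) (simp_all add: pcompose_mult pcompose_const one_pCons)
    have exact: "(a - b) * bern_rhs r s = (a ^ r - b ^ r) * a ^ s * b ^ s"
      unfolding a_def b_def by (rule bern_rhs_exact)
    have "(b - a) * pcompose (bern_rhs r s) ?c = pcompose ((a - b) * bern_rhs r s) ?c"
      by (simp only: pcompose_mult pcompose_diff ca cb)
    also have "\<dots> = (b ^ r - a ^ r) * b ^ s * a ^ s"
      unfolding exact by (simp only: pcompose_mult pcompose_diff pow ca cb)
    also have "\<dots> = - ((a - b) * bern_rhs r s)"
      unfolding exact by (simp add: algebra_simps)
    also have "\<dots> = (b - a) * bern_rhs r s"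
      by (simp add: algebra_simps)
    finally show ?thesis using ne by simp
  qed
  have ba: "pcompose ?b ?a = ?c" and ac: "pcompose ?a ?c = ?b"
    by (simp_all add: pcompose_pCons)
  have "pcompose ?C ?a - ?C = pcompose (bern_rhs r s) ?c"
    unfolding B(2)[symmetric] pcompose_diff pcompose_uminus pcompose_assoc[symmetric] ba ac
    by simp
  then have diff: "pcompose ?C ?a - ?C = pcompose (bern_B r s) ?a - bern_B r s"
    unfolding sym B(2) .
  have "?C = bern_B r s"
    by (rule difference_unique[OF _ B(1) diff]) (simp add: poly_pcompose B(1))
  then show ?thesis by (metis minus_minus)
qed

lemma bern_hom_uminus:
  assumes "r \<ge> 1"
  shows "bern_hom r s (- y) z = - bern_hom r s y z"
proof -
  have odd: "- ((-1) ^ k * coeff (bern_B r s) k) = coeff (bern_B r s) k" for k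
    using arg_cong[OF bern_B_odd[OF assms, of s], of "\<lambda>p. coeff p k"]
    by (simp add: coeff_pcompose_linear)
  have "Cst (coeff (bern_B r s) k) * (- y) ^ k = - (Cst (coeff (bern_B r s) k) * y ^ k)" for k
    using odd[of k] by (cases "even k") auto
  then show ?thesis by (simp add: bern_hom_def sum_negf)
qed

lemma bern_hom_zero:
  assumes "r \<ge> 1"
  shows "bern_hom r s 0 z = 0"
proof -
  have "coeff (bern_B r s) 0 = 0"
    using bern_B(1)[OF assms, of s] by (simp add: poly_0_coeff_0)
  then have "Cst (coeff (bern_B r s) k) * 0 ^ k = 0" for k by (cases k) auto
  then show ?thesis unfolding bern_hom_def by (intro sum.neutral ballI) (simp only: mult_zero_left)
qed

section \<open>The coefficients of the derivations as functions of one argument\<close>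

lemma prod_diff_eq_esym:
  assumes "finite A"
  shows "(\<Prod>t\<in>A. c - f t) = (\<Sum>k\<in>{0..card A}. (-1) ^ k * esym k f A * c ^ (card A - k))"
proof -
  let ?g = "\<lambda>B. (-1) ^ card B * (\<Prod>t\<in>B. f t) * c ^ (card A - card B)"
  have "(\<Prod>t\<in>A. c - f t) = (\<Prod>t\<in>A. - f t + c)"
    by (simp add: algebra_simps)
  also have "\<dots> = (\<Sum>B\<in>Pow A. (\<Prod>t\<in>B. - f t) * (\<Prod>t\<in>A - B. c))"
    using assms by (rule prod_add)
  also have "\<dots> = (\<Sum>B\<in>Pow A. ?g B)"
    using assms
    by (intro sum.cong refl) (auto simp: prod_uminus card_Diff_subset finite_subset)
  also have "\<dots> = (\<Sum>k\<in>{0..card A}. \<Sum>B\<in>{B. B \<in> Pow A \<and> card B = k}. ?g B)"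
    using assms by (intro sum.group[symmetric]) (auto intro: card_mono)
  also have "\<dots> = (\<Sum>k\<in>{0..card A}. (-1) ^ k * esym k f A * c ^ (card A - k))"
    unfolding esym_def sum_distrib_left sum_distrib_right
    by (intro sum.cong) auto
  finally show ?thesis .
qed

lemma sum_disjoint_pairs_eq_prod:
  fixes f g :: "nat \<Rightarrow> mpol"
  assumes "finite A"
  shows "(\<Sum>(N1, N2) | N1 \<subseteq> A \<and> N2 \<subseteq> A \<and> N1 \<inter> N2 = {}.
      (\<Prod>t\<in>N1. f t) * (\<Prod>t\<in>N2. g t) * c ^ (card A - card N1 - card N2)) = (\<Prod>t\<in>A. f t + (g t + c))"
proof -
  have "(\<Prod>t\<in>A. f t + (g t + c)) = (\<Sum>N1\<in>Pow A. (\<Prod>t\<in>N1. f t) * (\<Prod>t\<in>A - N1. g t + c))"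
    using assms by (rule prod_add)
  also have "\<dots> = (\<Sum>N1\<in>Pow A. \<Sum>N2\<in>Pow (A - N1).
      (\<Prod>t\<in>N1. f t) * (\<Prod>t\<in>N2. g t) * c ^ (card A - card N1 - card N2))"
  proof (intro sum.cong refl)
    fix N1 assume N1: "N1 \<in> Pow A"
    then have fin: "finite N1" "finite (A - N1)" using assms finite_subset by auto
    have "(\<Prod>t\<in>A - N1. g t + c) = (\<Sum>N2\<in>Pow (A - N1). (\<Prod>t\<in>N2. g t) * (\<Prod>t\<in>(A - N1) - N2. c))"
      using fin(2) by (rule prod_add)
    also have "\<dots> = (\<Sum>N2\<in>Pow (A - N1). (\<Prod>t\<in>N2. g t) * c ^ (card A - card N1 - card N2))"
    proof (intro sum.cong refl)
      fix N2 assume "N2 \<in> Pow (A - N1)"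
      then have "card (A - N1 - N2) = card A - card N1 - card N2"
        using N1 fin finite_subset[of N2 "A - N1"] by (simp add: card_Diff_subset)
      then show "(\<Prod>t\<in>N2. g t) * (\<Prod>t\<in>(A - N1) - N2. c) = (\<Prod>t\<in>N2. g t) * c ^ (card A - card N1 - card N2)"
        by simp
    qed
    finally show "(\<Prod>t\<in>N1. f t) * (\<Prod>t\<in>A - N1. g t + c) = (\<Sum>N2\<in>Pow (A - N1).
        (\<Prod>t\<in>N1. f t) * (\<Prod>t\<in>N2. g t) * c ^ (card A - card N1 - card N2))"
      by (simp add: sum_distrib_left mult.assoc)
  qed
  also have "\<dots> = (\<Sum>(N1, N2)\<in>(SIGMA N1:Pow A. Pow (A - N1)).
      (\<Prod>t\<in>N1. f t) * (\<Prod>t\<in>N2. g t) * c ^ (card A - card N1 - card N2))"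
    using assms by (intro sum.Sigma) auto
  also have "(SIGMA N1:Pow A. Pow (A - N1)) = {(N1, N2). N1 \<subseteq> A \<and> N2 \<subseteq> A \<and> N1 \<inter> N2 = {}}"
    by auto
  finally show ?thesis ..
qed

text \<open>The coefficient of \<open>pd i\<close> in \<open>phi_B l j\<close> is, up to the sign \<open>(-1)\<^sup>j\<close>, the value at \<open>Var i\<close> of
  a function that does not depend on \<open>i\<close>.\<close>

definition shi_fun :: "nat \<Rightarrow> nat \<Rightarrow> mpol \<Rightarrow> mpol" where
  "shi_fun l j y =
     (\<Sum>(N1, N2) | N1 \<subseteq> {1..<j} \<and> N2 \<subseteq> {1..<j} \<and> N1 \<inter> N2 = {}.
        (\<Prod>t\<in>N1. Var t ^ 2) * (\<Prod>t\<in>N2. - (Var t * Zv))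
        * (\<Sum>k2\<in>{0..1}. \<Sum>k3\<in>{0..l - j}.
             (- 1) ^ (k2 + k3) * esym k2 Var {j} * esym k3 (\<lambda>t. Var t ^ 2) {j + 1..l}
             * bern_hom (2 * l + 2 - 2 * j - k2 - 2 * k3) ((j - 1) - card N1 - card N2) y Zv))"

lemma phi_coeff_eq_shi_fun: "phi_coeff l j i = shi_fun l j (Var i)"
  by (simp add: phi_coeff_def shi_fun_def)

lemma shi_fun_zero:
  assumes "j \<in> {1..l}"
  shows "shi_fun l j 0 = 0"
  unfolding shi_fun_def using assms
  by (intro sum.neutral ballI) (auto simp: bern_hom_zero)

lemma shi_fun_uminus:
  assumes "j \<in> {1..l}"
  shows "shi_fun l j (- y) = - shi_fun l j y"
proof -
  have "bern_hom (2 * l + 2 - 2 * j - k2 - 2 * k3) s (- y) Zv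
      = - bern_hom (2 * l + 2 - 2 * j - k2 - 2 * k3) s y Zv"
    if "k2 \<in> {0..1}" "k3 \<in> {0..l - j}" for k2 k3 s
    using assms that by (intro bern_hom_uminus) auto
  then show ?thesis
    unfolding shi_fun_def case_prod_beta
    by (simp only: sum_negf[symmetric] mult_minus_right[symmetric] cong: sum.cong)
qed

text \<open>The functions given by polynomials of degree at most \<open>n\<close> with coefficients in the ring of
  multivariate polynomials.\<close>

definition polynomial_fun :: "nat \<Rightarrow> (mpol \<Rightarrow> mpol) \<Rightarrow> bool" where
  "polynomial_fun n F \<longleftrightarrow> (\<exists>P. degree P \<le> n \<and> (\<forall>y. poly P y = F y))"

lemma polynomial_fun_sum:
  assumes "\<And>i. i \<in> A \<Longrightarrow> polynomial_fun n (F i)"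
  shows "polynomial_fun n (\<lambda>y. \<Sum>i\<in>A. F i y)"
proof (cases "finite A")
  case True
  obtain P where P: "\<forall>i\<in>A. degree (P i) \<le> n \<and> (\<forall>y. poly (P i) y = F i y)"
    using assms unfolding polynomial_fun_def by metis
  show ?thesis
    unfolding polynomial_fun_def using P True
    by (intro exI[of _ "\<Sum>i\<in>A. P i"]) (auto simp: poly_sum intro: degree_sum_le)
next
  case False
  then show ?thesis unfolding polynomial_fun_def by (intro exI[of _ 0]) auto
qed

lemma polynomial_fun_cmult:
  assumes "polynomial_fun n F"
  shows "polynomial_fun n (\<lambda>y. c * F y)"
proof -
  obtain P where "degree P \<le> n" "\<forall>y. poly P y = F y"
    using assms unfolding polynomial_fun_def by blast
  then show ?thesis
    unfolding polynomial_fun_def by (intro exI[of _ "smult c P"]) (auto intro: order.trans[OF degree_smult_le])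
qed

lemma polynomial_fun_shi_fun:
  assumes "j \<in> {1..l}"
  shows "polynomial_fun (2 * l) (shi_fun l j)"
proof -
  have power: "polynomial_fun n (\<lambda>y. y ^ k)" if "k \<le> n" for n k
    unfolding polynomial_fun_def using that
    by (intro exI[of _ "monom 1 k"]) (auto simp: poly_monom degree_monom_eq)
  have bern: "polynomial_fun (2 * l) (\<lambda>y. bern_hom r s y Zv)" if "r + 2 * s \<le> 2 * l" for r s
  proof -
    have "bern_hom r s y Zv
        = (\<Sum>k\<le>r + 2 * s. (Cst (coeff (bern_B r s) k) * Zv ^ (r + 2 * s - k)) * y ^ k)" for y
      unfolding bern_hom_def by (simp only: mult_ac)
    then show ?thesis
      using that by (simp only:) (intro polynomial_fun_sum polynomial_fun_cmult power, auto)
  qed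
  have "polynomial_fun (2 * l) (\<lambda>y. shi_fun l j y)"
    unfolding shi_fun_def case_prod_beta using assms
    by (intro polynomial_fun_sum polynomial_fun_cmult bern) auto
  then show ?thesis .
qed

lemma diff_dvd_poly_diff:
  fixes P :: "'a::comm_ring_1 poly"
  shows "y - y' dvd poly P y - poly P y'"
proof (induction P)
  case (pCons a P)
  have "poly (pCons a P) y - poly (pCons a P) y' = y * (poly P y - poly P y') + (y - y') * poly P y'"
    by (simp add: algebra_simps)
  then show ?case using pCons by (metis dvd_add dvd_mult dvd_triv_left)
qed simp

lemma shi_fun_congruent:
  assumes "j \<in> {1..l}"
  shows "y - y' dvd shi_fun l j y - shi_fun l j y'"
  using polynomial_fun_shi_fun[OF assms] diff_dvd_poly_diff[of y y']
  unfolding polynomial_fun_def by metis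

text \<open>The numerator of the difference \<open>shi_fun l j (y + z) - shi_fun l j y\<close>, for \<open>a = y + z\<close> and
  \<open>b = -y\<close>. Its factors account for the divisibility of values of \<open>shi_fun\<close> by the
  linear forms that involve \<open>z\<close>.\<close>

definition shi_numerator :: "nat \<Rightarrow> nat \<Rightarrow> mpol \<Rightarrow> mpol \<Rightarrow> mpol" where
  "shi_numerator l j a b = (\<Prod>t\<in>{1..<j}. (Var t - a) * (Var t - b))
     * (a * (a - Var j) * (\<Prod>t\<in>{j + 1..l}. a ^ 2 - Var t ^ 2)
        - b * (b - Var j) * (\<Prod>t\<in>{j + 1..l}. b ^ 2 - Var t ^ 2))"

text \<open>As \<open>a + b = z\<close>, the sum over \<open>N1, N2\<close> is the expansion of the product of the factors
  \<open>x\<^sub>t\<^sup>2 - x\<^sub>t z + a b = (x\<^sub>t - a) (x\<^sub>t - b)\<close> for \<open>t < j\<close>. The sum over \<open>k2, k3\<close> of the powers of \<open>a\<close>, and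
  likewise of \<open>b\<close>, is the expansion of \<open>a (a - x\<^sub>j) \<Prod>\<^sub>t\<^sub>>\<^sub>j (a\<^sup>2 - x\<^sub>t\<^sup>2)\<close>.\<close>

lemma shi_fun_difference:
  assumes j: "j \<in> {1..l}" and ab: "a = y + Zv" "b = - y"
  shows "(a - b) * (shi_fun l j (y + Zv) - shi_fun l j y) = Zv * shi_numerator l j a b"
proof -
  let ?N = "{(N1, N2). N1 \<subseteq> {1..<j} \<and> N2 \<subseteq> {1..<j} \<and> N1 \<inter> N2 = {}}"
  let ?w = "\<lambda>N1 N2. (\<Prod>t\<in>N1. Var t ^ 2) * (\<Prod>t\<in>N2. - (Var t * Zv))"
  let ?s = "\<lambda>N1 N2. (j - 1) - card N1 - card N2"
  let ?d = "\<lambda>k2 k3. (- 1) ^ (k2 + k3) * esym k2 Var {j} * esym k3 (\<lambda>t. Var t ^ 2) {j + 1..l}"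
  let ?r = "\<lambda>k2 k3. 2 * l + 2 - 2 * j - k2 - 2 * k3"
  define D where "D = (\<lambda>r s. bern_hom r s (y + Zv) Zv - bern_hom r s y Zv)"
  have D: "(a - b) * D (?r k2 k3) s = Zv * (a ^ ?r k2 k3 - b ^ ?r k2 k3) * (a * b) ^ s"
    if "k2 \<in> {0..1}" "k3 \<in> {0..l - j}" for k2 k3 s
    unfolding D_def ab using j that by (intro bern_hom_difference) auto
  have esum: "(\<Sum>k2\<in>{0..1}. \<Sum>k3\<in>{0..l - j}. ?d k2 k3 * c ^ ?r k2 k3)
      = c * (c - Var j) * (\<Prod>t\<in>{j + 1..l}. c ^ 2 - Var t ^ 2)" for c
  proof -
    have 1: "c - Var j = (\<Sum>k2\<in>{0..1}. (-1) ^ k2 * esym k2 Var {j} * c ^ (1 - k2))"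
      using prod_diff_eq_esym[of "{j}" c Var] by simp
    have 2: "(\<Prod>t\<in>{j + 1..l}. c ^ 2 - Var t ^ 2)
        = (\<Sum>k3\<in>{0..l - j}. (-1) ^ k3 * esym k3 (\<lambda>t. Var t ^ 2) {j + 1..l} * (c ^ 2) ^ (l - j - k3))"
      using prod_diff_eq_esym[of "{j + 1..l}" "c ^ 2" "\<lambda>t. Var t ^ 2"] by simp
    have "c ^ ?r k2 k3 = c * c ^ (1 - k2) * (c ^ 2) ^ (l - j - k3)"
      if "k2 \<in> {0..1}" "k3 \<in> {0..l - j}" for k2 k3
    proof -
      have "?r k2 k3 = 1 + (1 - k2) + 2 * (l - j - k3)" using that j by auto
      then show ?thesis by (simp only: power_add power_mult power_one_right)
    qed
    then have "(\<Sum>k2\<in>{0..1}. \<Sum>k3\<in>{0..l - j}. ?d k2 k3 * c ^ ?r k2 k3)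
        = (\<Sum>k2\<in>{0..1}. \<Sum>k3\<in>{0..l - j}. c * ((-1) ^ k2 * esym k2 Var {j} * c ^ (1 - k2))
            * ((-1) ^ k3 * esym k3 (\<lambda>t. Var t ^ 2) {j + 1..l} * (c ^ 2) ^ (l - j - k3)))"
      by (intro sum.cong refl) (simp only: power_add mult_ac)
    also have "\<dots> = c * (c - Var j) * (\<Prod>t\<in>{j + 1..l}. c ^ 2 - Var t ^ 2)"
      unfolding 1 2 mult.assoc[of c] sum_product
      unfolding sum_distrib_left ..
    finally show ?thesis .
  qed
  have "(a - b) * (shi_fun l j (y + Zv) - shi_fun l j y)
      = (a - b) * (\<Sum>(N1, N2)\<in>?N. ?w N1 N2
          * (\<Sum>k2\<in>{0..1}. \<Sum>k3\<in>{0..l - j}. ?d k2 k3 * D (?r k2 k3) (?s N1 N2)))"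
    unfolding shi_fun_def D_def case_prod_beta
    by (simp only: sum_subtractf right_diff_distrib)
  also have "\<dots> = (\<Sum>(N1, N2)\<in>?N. ?w N1 N2
          * (\<Sum>k2\<in>{0..1}. \<Sum>k3\<in>{0..l - j}. ?d k2 k3 * ((a - b) * D (?r k2 k3) (?s N1 N2))))"
    unfolding case_prod_beta sum_distrib_left by (simp only: mult_ac)
  also have "\<dots> = (\<Sum>(N1, N2)\<in>?N. ?w N1 N2
          * (\<Sum>k2\<in>{0..1}. \<Sum>k3\<in>{0..l - j}.
              ?d k2 k3 * (Zv * (a ^ ?r k2 k3 - b ^ ?r k2 k3) * (a * b) ^ ?s N1 N2)))"
    by (simp only: D cong: sum.cong)
  also have "\<dots> = (\<Sum>(N1, N2)\<in>?N. ?w N1 N2 * (a * b) ^ ?s N1 N2)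
      * (Zv * (\<Sum>k2\<in>{0..1}. \<Sum>k3\<in>{0..l - j}. ?d k2 k3 * (a ^ ?r k2 k3 - b ^ ?r k2 k3)))"
  proof -
    have "?w N1 N2 * (\<Sum>k2\<in>{0..1}. \<Sum>k3\<in>{0..l - j}.
          ?d k2 k3 * (Zv * (a ^ ?r k2 k3 - b ^ ?r k2 k3) * (a * b) ^ ?s N1 N2))
        = ?w N1 N2 * (a * b) ^ ?s N1 N2
          * (Zv * (\<Sum>k2\<in>{0..1}. \<Sum>k3\<in>{0..l - j}. ?d k2 k3 * (a ^ ?r k2 k3 - b ^ ?r k2 k3)))" for N1 N2
      unfolding sum_distrib_left by (simp only: mult_ac)
    then show ?thesis
      unfolding case_prod_beta sum_distrib_right by (simp only:)
  qed
  also have "(\<Sum>k2\<in>{0..1}. \<Sum>k3\<in>{0..l - j}. ?d k2 k3 * (a ^ ?r k2 k3 - b ^ ?r k2 k3))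
      = a * (a - Var j) * (\<Prod>t\<in>{j + 1..l}. a ^ 2 - Var t ^ 2)
        - b * (b - Var j) * (\<Prod>t\<in>{j + 1..l}. b ^ 2 - Var t ^ 2)"
    unfolding right_diff_distrib sum_subtractf esum ..
  also have "(\<Sum>(N1, N2)\<in>?N. ?w N1 N2 * (a * b) ^ ?s N1 N2)
      = (\<Prod>t\<in>{1..<j}. Var t ^ 2 + (- (Var t * Zv) + a * b))"
    using sum_disjoint_pairs_eq_prod[of "{1..<j}" "\<lambda>t. Var t ^ 2" "\<lambda>t. - (Var t * Zv)" "a * b"]
    by simp
  also have "\<dots> = (\<Prod>t\<in>{1..<j}. (Var t - a) * (Var t - b))"
    by (intro prod.cong refl) (simp add: ab algebra_simps power2_eq_square)
  finally show ?thesis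
    unfolding shi_numerator_def by (simp only: mult_ac)
qed

section \<open>The linear forms of the cone over the Shi arrangement\<close>

text \<open>The entry of a family at a signed index, with the value 0 at the index 0. For the family of
  the variables these are the weights \<open>0\<close> and \<open>\<plusminus>x\<^sub>q\<close> that occur in the roots \<open>x\<^sub>p - \<dots>\<close>.\<close>

definition signed :: "(nat \<Rightarrow> mpol) \<Rightarrow> int \<Rightarrow> mpol" where
  "signed v c = (if c = 0 then 0 else if c > 0 then v (nat c) else - v (nat (- c)))"

text \<open>The linear forms defining the hyperplanes other than \<open>z = 0\<close>, all written as
  \<open>x\<^sub>p - (0 or \<plusminus>x\<^sub>q) - (0 or z)\<close> with \<open>p < q\<close>. In an index \<open>(p, c, e)\<close> the integer \<open>c\<close> is 0 or \<open>\<plusminus>q\<close>, and \<open>e\<close>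
  tells whether \<open>z\<close> is subtracted.\<close>

definition shi_index :: "nat \<Rightarrow> (nat \<times> int \<times> bool) set" where
  "shi_index l = (SIGMA p:{1..l}. {c. \<bar>c\<bar> \<le> int l \<and> (c = 0 \<or> int p < \<bar>c\<bar>)} \<times> UNIV)"

definition shi_shift :: "int \<Rightarrow> bool \<Rightarrow> mpol" where
  "shi_shift c e = signed Var c + (if e then Zv else 0)"

definition shi_form :: "nat \<times> int \<times> bool \<Rightarrow> mpol" where
  "shi_form = (\<lambda>(p, c, e). Var p - shi_shift c e)"

lemma in_shi_index_iff:
  "(p, c, e) \<in> shi_index l \<longleftrightarrow> 1 \<le> p \<and> p \<le> l \<and> \<bar>c\<bar> \<le> int l \<and> (c = 0 \<or> int p < \<bar>c\<bar>)"
  by (auto simp: shi_index_def)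

lemma signed_in_PolS:
  assumes "\<bar>c\<bar> \<le> int l" "\<And>i. i \<in> {1..l} \<Longrightarrow> v i \<in> PolS l"
  shows "signed v c \<in> PolS l"
proof -
  have "v (nat \<bar>c\<bar>) \<in> PolS l" if "c \<noteq> 0"
    using that assms(1) by (intro assms(2)) auto
  then show ?thesis by (auto simp: signed_def intro: PolS_uminus)
qed

lemma shi_form_in_PolS:
  assumes "h \<in> shi_index l"
  shows "shi_form h \<in> PolS l"
proof -
  obtain p c e where h: "h = (p, c, e)" by (metis prod_cases3)
  then have "signed Var c \<in> PolS l"
    using assms by (intro signed_in_PolS) (auto simp: in_shi_index_iff intro: PolS_Var)
  then have "shi_shift c e \<in> PolS l"
    by (simp add: shi_shift_def PolS_add PolS_Var)
  moreover have "Var p \<in> PolS l"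
    using assms h by (intro PolS_Var) (simp add: in_shi_index_iff)
  ultimately show ?thesis by (simp add: h shi_form_def PolS_diff)
qed

lemma subst_shi_shift:
  assumes "(p, c, e) \<in> shi_index l" "(p, c', e') \<in> shi_index l'"
  shows "subst_var (Var(p := \<beta>)) (signed Var c') = signed Var c'"
    and "subst_var (Var(p := \<beta>)) (shi_shift c' e') = shi_shift c' e'"
proof -
  have "p \<noteq> 0" "p \<noteq> nat \<bar>c'\<bar>" using assms by (auto simp: in_shi_index_iff)
  then have var: "subst_var (Var(p := \<beta>)) Zv = Zv"
    "subst_var (Var(p := \<beta>)) (Var (nat \<bar>c'\<bar>)) = Var (nat \<bar>c'\<bar>)" by simp_all
  then show signed: "subst_var (Var(p := \<beta>)) (signed Var c') = signed Var c'"
    by (auto simp: signed_def subst_var_uminus)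
  show "subst_var (Var(p := \<beta>)) (shi_shift c' e') = shi_shift c' e'"
    using var(1) by (simp add: shi_shift_def subst_var_add signed)
qed

lemma shi_form_dvd_iff:
  assumes "(p, c, e) \<in> shi_index l"
  shows "shi_form (p, c, e) dvd f \<longleftrightarrow> subst_var (Var(p := shi_shift c e)) f = 0"
  unfolding shi_form_def prod.case
  by (intro linear_dvd_iff_subst_zero subst_shi_shift(2)[OF assms assms])

lemma shi_form_prime:
  assumes "h \<in> shi_index l" "shi_form h dvd f * g" "\<not> shi_form h dvd f"
  shows "shi_form h dvd g"
  using assms by (cases h) (auto simp: shi_form_dvd_iff subst_var_mult)

lemma lin_coeff_signed_Var:
  "lin_coeff i (signed Var c) = (if c \<noteq> 0 \<and> i = nat \<bar>c\<bar> then sgn (real_of_int c) else 0)"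
  by (auto simp: signed_def)

lemma lin_coeff_shi_shift:
  "lin_coeff i (shi_shift c e)
    = (if c \<noteq> 0 \<and> i = nat \<bar>c\<bar> then sgn (real_of_int c) else 0) + (if e \<and> i = 0 then 1 else 0)"
  by (simp add: shi_shift_def lin_coeff_signed_Var)

lemma shi_form_not_dvd:
  assumes "h \<in> shi_index l" "h' \<in> shi_index l" "h \<noteq> h'"
  shows "\<not> shi_form h dvd shi_form h'"
proof -
  obtain p c e p' c' e' where h: "h = (p, c, e)" "h' = (p', c', e')" by (metis prod_cases3)
  note idx = assms(1,2)[unfolded h]
  let ?f = "subst_var (Var(p := shi_shift c e)) (shi_form h')"
  have "?f \<noteq> 0"
  proof (cases "p' = p")
    case True
    have f: "?f = shi_shift c e - shi_shift c' e'"
      using True idx subst_shi_shift(2)[of p c e l c' e' l]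
      by (simp add: h shi_form_def subst_var_diff)
    show ?thesis
    proof (cases "c = c'")
      case same: True
      then have "lin_coeff 0 ?f \<noteq> 0"
        using True assms(3) h unfolding f by (simp add: lin_coeff_shi_shift)
      then show ?thesis by (rule nonzero_if_lin_coeff)
    next
      case False
      show ?thesis
      proof (cases "c = 0")
        case True
        then have "lin_coeff (nat \<bar>c'\<bar>) ?f = - sgn (real_of_int c')"
          using False unfolding f by (simp add: lin_coeff_shi_shift)
        then show ?thesis
          using True False by (intro nonzero_if_lin_coeff[of "nat \<bar>c'\<bar>"]) (simp add: sgn_eq_0_iff)
      next
        case c: False
        then have "lin_coeff (nat \<bar>c\<bar>) ?f
            = sgn (real_of_int c) - (if c' \<noteq> 0 \<and> nat \<bar>c\<bar> = nat \<bar>c'\<bar> then sgn (real_of_int c') else 0)"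
          unfolding f lin_coeff_simps lin_coeff_shi_shift by simp
        moreover have "c' = - c" if "nat \<bar>c\<bar> = nat \<bar>c'\<bar>"
          using that False by linarith
        ultimately have "lin_coeff (nat \<bar>c\<bar>) ?f \<in> {sgn (real_of_int c), 2 * sgn (real_of_int c)}"
          by (cases "nat \<bar>c\<bar> = nat \<bar>c'\<bar>") (simp_all add: c)
        then show ?thesis
          using c by (intro nonzero_if_lin_coeff[of "nat \<bar>c\<bar>"]) (auto simp: sgn_eq_0_iff)
      qed
    qed
  next
    case False
    have f: "?f = Var p' - subst_var (Var(p := shi_shift c e)) (shi_shift c' e')"
      using False by (simp add: h shi_form_def subst_var_diff)
    have p: "p \<noteq> 0" "p' \<noteq> 0"
      using idx by (auto simp: in_shi_index_iff)
    have var: "lin_coeff p' (subst_var (Var(p := shi_shift c e)) (Var (nat \<bar>c'\<bar>))) = 0" if "c' \<noteq> 0"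
    proof (cases "nat \<bar>c'\<bar> = p")
      case True
      then have "c = 0 \<or> p' \<noteq> nat \<bar>c\<bar>"
        using idx that by (auto simp: in_shi_index_iff)
      then show ?thesis using True p by (auto simp: lin_coeff_shi_shift)
    next
      case False
      have "p' \<noteq> nat \<bar>c'\<bar>" using idx that by (auto simp: in_shi_index_iff)
      then show ?thesis using False by simp
    qed
    have "lin_coeff p' (subst_var (Var(p := shi_shift c e)) (signed Var c')) = 0"
      using var by (auto simp: signed_def subst_var_uminus)
    then have "lin_coeff p' ?f = 1"
      using p unfolding f by (simp add: shi_shift_def subst_var_add)
    then show ?thesis
      by (intro nonzero_if_lin_coeff[of p']) simp
  qed
  then show ?thesis
    using shi_form_dvd_iff[OF idx(1)] h by simp
qed

lemma shi_form_not_dvd_prod: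
  assumes "h \<in> shi_index l" "A \<subseteq> shi_index l" "finite A" "h \<notin> A"
  shows "\<not> shi_form h dvd (\<Prod>h\<in>A. shi_form h)"
proof -
  obtain p c e where h: "h = (p, c, e)" by (metis prod_cases3)
  have "subst_var (Var(p := shi_shift c e)) (shi_form h') \<noteq> 0" if "h' \<in> A" for h'
  proof -
    have "h' \<in> shi_index l" "h \<noteq> h'" using that assms by auto
    from shi_form_not_dvd[OF assms(1) this] show ?thesis
      unfolding h shi_form_dvd_iff[OF assms(1)[unfolded h]] .
  qed
  then show ?thesis
    unfolding h shi_form_dvd_iff[OF assms(1)[unfolded h]] subst_var_prod prod_zero_iff[OF assms(3)]
    by blast
qed

lemma prod_shi_form_dvd:
  assumes "A \<subseteq> shi_index l" "finite A" "\<And>h. h \<in> A \<Longrightarrow> shi_form h dvd f"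
  shows "(\<Prod>h\<in>A. shi_form h) dvd f"
  using assms(2,1,3)
proof (induction A)
  case (insert h A)
  have "(\<Prod>h\<in>A. shi_form h) dvd f"
    using insert.prems by (intro insert.IH) simp_all
  then obtain q where q: "f = (\<Prod>h\<in>A. shi_form h) * q" by (rule dvdE)
  have h: "h \<in> shi_index l" using insert.prems by simp
  have "shi_form h dvd (\<Prod>h\<in>A. shi_form h) * q"
    using insert.prems(2)[of h] unfolding q by simp
  then have "shi_form h dvd q"
    by (rule shi_form_prime[OF h]) (use shi_form_not_dvd_prod[OF h _ insert.hyps] insert.prems(1) in simp)
  then have "(\<Prod>h\<in>A. shi_form h) * shi_form h dvd f"
    unfolding q by (rule mult_dvd_mono[OF dvd_refl])
  then show ?case
    using insert.hyps by (simp add: mult.commute)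
qed simp

lemma finite_shi_index: "finite (shi_index l)"
proof -
  have "shi_index l \<subseteq> {1..l} \<times> {- int l..int l} \<times> UNIV"
    by (auto simp: shi_index_def)
  then show ?thesis by (rule finite_subset) simp
qed

lemma card_shi_index: "card (shi_index l) = 2 * l * l"
proof -
  let ?C = "\<lambda>p. {c. \<bar>c\<bar> \<le> int l \<and> (c = 0 \<or> int p < \<bar>c\<bar>)}"
  have C: "card (?C p) = 1 + 2 * (l - p)" and fin: "finite (?C p)" for p
  proof -
    have eq: "?C p = insert 0 ({int p<..int l} \<union> {- int l..<- int p})" by auto
    show "finite (?C p)" unfolding eq by simp
    have "card ({int p<..int l} \<union> {- int l..<- int p}) = 2 * (l - p)"
      by (subst card_Un_disjoint) auto
    then show "card (?C p) = 1 + 2 * (l - p)" unfolding eq by (subst card_insert_disjoint) auto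
  qed
  have "card (shi_index l) = (\<Sum>p\<in>{1..l}. 2 * (1 + 2 * (l - p)))"
    unfolding shi_index_def using C fin by (subst card_SigmaI) (auto simp: card_cartesian_product)
  also have "\<dots> = (\<Sum>k<l. 2 * (1 + 2 * k))"
    by (rule sum.reindex_bij_witness[of _ "\<lambda>k. l - k" "\<lambda>p. l - p"]) auto
  also have "\<dots> = 2 * l * l"
    by (induction l) (auto simp: algebra_simps)
  finally show ?thesis .
qed

text \<open>The values on \<open>x\<^sub>1, \<dots>, x\<^sub>l\<close> of the derivations that kill \<open>z\<close> and belong to the derivation module
  of the arrangement.\<close>

definition shi_vector :: "nat \<Rightarrow> (nat \<Rightarrow> mpol) \<Rightarrow> bool" where
  "shi_vector l v \<longleftrightarrow> (\<forall>i\<in>{1..l}. v i \<in> PolS l)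
     \<and> (\<forall>(p, c, e)\<in>shi_index l. shi_form (p, c, e) dvd v p - signed v c)"

lemma shi_fun_in_PolS:
  assumes "j \<in> {1..l}" "y \<in> PolS l"
  shows "shi_fun l j y \<in> PolS l"
  unfolding shi_fun_def case_prod_beta esym_def bern_hom_def using assms
  by (intro PolS_intros) (auto intro!: PolS_intros)

lemma shi_fun_signed:
  assumes "j \<in> {1..l}"
  shows "shi_fun l j (signed Var c) = signed (\<lambda>i. shi_fun l j (Var i)) c"
  using assms by (simp add: signed_def shi_fun_zero shi_fun_uminus)

text \<open>For \<open>p < j\<close> the form divides the common factor \<open>x\<^sub>p - a\<close>; for \<open>p \<ge> j\<close> it divides the factor
  \<open>a - x\<^sub>j\<close> or \<open>a\<^sup>2 - x\<^sub>p\<^sup>2\<close> of the minuend, and the subtrahend is 0 as \<open>b\<close> is 0 or \<open>\<plusminus>x\<^sub>q\<close> with \<open>q > j\<close>.\<close>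

lemma shi_form_dvd_numerator:
  assumes "(p, c, True) \<in> shi_index l" "j \<in> {1..l}"
  shows "shi_form (p, c, True) dvd shi_numerator l j (signed Var c + Zv) (- signed Var c)"
proof -
  define a b where "a = signed Var c + Zv" and "b = - signed Var c"
  have form: "shi_form (p, c, True) = Var p - a"
    by (simp add: shi_form_def shi_shift_def a_def)
  show ?thesis
  proof (cases "p < j")
    case True
    have "(Var p - a) * (Var p - b) dvd (\<Prod>t\<in>{1..<j}. (Var t - a) * (Var t - b))"
      using True assms by (intro dvd_prodI) (auto simp: in_shi_index_iff)
    then show ?thesis
      unfolding form shi_numerator_def a_def[symmetric] b_def[symmetric]
      using dvd_mult_left dvd_mult2 by blast
  next
    case False
    have "Var p - a dvd a * (a - Var j) * (\<Prod>t\<in>{j + 1..l}. a ^ 2 - Var t ^ 2)"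
    proof (cases "p = j")
      case True
      have "Var p - a dvd a - Var j" using True by (metis dvd_minus_iff dvd_refl minus_diff_eq)
      then show ?thesis by (intro dvd_mult2 dvd_mult)
    next
      case False
      have "Var p - a dvd a ^ 2 - Var p ^ 2"
        unfolding dvd_def by (rule exI[of _ "- (a + Var p)"]) (simp add: power2_eq_square algebra_simps)
      also have "\<dots> dvd (\<Prod>t\<in>{j + 1..l}. a ^ 2 - Var t ^ 2)"
        using False \<open>\<not> p < j\<close> assms by (intro dvd_prodI) (auto simp: in_shi_index_iff)
      finally show ?thesis by (rule dvd_mult)
    qed
    moreover have "b * (b - Var j) * (\<Prod>t\<in>{j + 1..l}. b ^ 2 - Var t ^ 2) = 0"
    proof (cases "c = 0")
      case True
      then show ?thesis by (simp add: b_def signed_def)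
    next
      case c: False
      have "b ^ 2 - Var (nat \<bar>c\<bar>) ^ 2 = 0" using c by (simp add: b_def signed_def)
      moreover have "nat \<bar>c\<bar> \<in> {j + 1..l}" using c False assms by (auto simp: in_shi_index_iff)
      ultimately have "(\<Prod>t\<in>{j + 1..l}. b ^ 2 - Var t ^ 2) = 0" by (intro prod_zero) auto
      then show ?thesis by simp
    qed
    ultimately have "Var p - a dvd a * (a - Var j) * (\<Prod>t\<in>{j + 1..l}. a ^ 2 - Var t ^ 2)
        - b * (b - Var j) * (\<Prod>t\<in>{j + 1..l}. b ^ 2 - Var t ^ 2)"
      by (simp only: diff_zero)
    then show ?thesis
      unfolding form shi_numerator_def a_def[symmetric] b_def[symmetric] by (rule dvd_mult)
  qed
qed

text \<open>Modulo a form that involves \<open>z\<close>, the value at \<open>x\<^sub>p\<close> is first shifted to \<open>y + z\<close> and then, by the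
  difference equation, to \<open>y\<close>, where \<open>y\<close> is 0 or \<open>\<plusminus>x\<^sub>q\<close>. The denominator \<open>2y + z\<close> is harmless, as it is
  not divisible by the form.\<close>

lemma shi_vector_shi_fun:
  assumes j: "j \<in> {1..l}"
  shows "shi_vector l (\<lambda>i. shi_fun l j (Var i))"
  unfolding shi_vector_def
proof safe
  show "shi_fun l j (Var i) \<in> PolS l" if "i \<in> {1..l}" for i
    using that by (intro shi_fun_in_PolS[OF j] PolS_Var) auto
next
  fix p c e assume h: "(p, c, e) \<in> shi_index l"
  let ?F = "shi_fun l j" and ?y = "signed Var c"
  have "shi_form (p, c, e) dvd ?F (Var p) - ?F ?y"
  proof (cases e)
    case False
    then show ?thesis
      using shi_fun_congruent[OF j, of "Var p" ?y] by (simp add: shi_form_def shi_shift_def)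
  next
    case True
    have "shi_form (p, c, e) dvd ?F (Var p) - ?F (?y + Zv)"
      using shi_fun_congruent[OF j, of "Var p" "?y + Zv"] True by (simp add: shi_form_def shi_shift_def)
    moreover have "shi_form (p, c, e) dvd ?F (?y + Zv) - ?F ?y"
    proof (rule shi_form_prime[OF h])
      have "shi_form (p, c, e) dvd Zv * shi_numerator l j (?y + Zv) (- ?y)"
        using shi_form_dvd_numerator[OF _ j, of p c] h True by simp
      then show "shi_form (p, c, e) dvd (?y + Zv - (- ?y)) * (?F (?y + Zv) - ?F ?y)"
        by (simp only: shi_fun_difference[OF j refl refl])
      have "subst_var (Var(p := shi_shift c e)) (?y + Zv - (- ?y)) = ?y + Zv - (- ?y)"
      proof -
        have "subst_var (Var(p := shi_shift c e)) Zv = Zv"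
          using h by (simp add: in_shi_index_iff)
        then show ?thesis
          by (simp only: subst_var_add subst_var_diff subst_var_uminus subst_shi_shift(1)[OF h h])
      qed
      moreover have "lin_coeff 0 (?y + Zv - (- ?y)) \<noteq> 0"
        unfolding lin_coeff_simps lin_coeff_signed_Var by simp
      ultimately show "\<not> shi_form (p, c, e) dvd ?y + Zv - (- ?y)"
        unfolding shi_form_dvd_iff[OF h] by (metis lin_coeff_simps(1))
    qed
    ultimately have "shi_form (p, c, e) dvd (?F (Var p) - ?F (?y + Zv)) + (?F (?y + Zv) - ?F ?y)"
      by (rule dvd_add)
    then show ?thesis by (simp only: diff_add_cancel add_diff_eq)
  qed
  then show "shi_form (p, c, e) dvd ?F (Var p) - signed (\<lambda>i. ?F (Var i)) c"
    unfolding shi_fun_signed[OF j] .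
qed

section \<open>Derivations\<close>

lemma pd_single:
  "pd i (Poly_Mapping.single m a)
    = Poly_Mapping.single (m - Poly_Mapping.single i 1) (real (Poly_Mapping.lookup m i) * a)"
  by (cases "a = 0") (auto simp: pd_def)

lemma pd_add: "pd i (f + g) = pd i f + pd i g"
  unfolding pd_def by (rule setsum_keys_plus_distrib) (simp_all add: single_add distrib_left)

lemma pd_mult: "pd i (f * g) = f * pd i g + g * pd i f"
proof -
  have monom: "pd i (s * t) = s * pd i t + t * pd i s"
    if "s = Poly_Mapping.single m a" "t = Poly_Mapping.single n b" for s t m n a b
  proof -
    let ?e = "Poly_Mapping.single i (Suc 0)"
    have shift: "k + (m - ?e) = k + m - ?e" if "Poly_Mapping.lookup m i \<noteq> 0" for k m :: "nat \<Rightarrow>\<^sub>0 nat"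
      using that by (intro poly_mapping_eqI) (auto simp: lookup_add lookup_minus lookup_single when_def)
    have 1: "s * pd i t
        = Poly_Mapping.single (m + n - ?e) (a * (real (Poly_Mapping.lookup n i) * b))"
      unfolding that pd_single mult_single
      by (cases "Poly_Mapping.lookup n i = 0") (auto simp: shift)
    have 2: "t * pd i s
        = Poly_Mapping.single (m + n - ?e) (b * (real (Poly_Mapping.lookup m i) * a))"
      unfolding that pd_single mult_single
      by (cases "Poly_Mapping.lookup m i = 0") (auto simp: shift add.commute[of n m])
    show ?thesis
      unfolding 1 2 unfolding that mult_single pd_single single_add[symmetric]
      by (simp add: lookup_add algebra_simps)
  qed
  show ?thesis
  proof (rule additive_mpol_eqI[of "\<lambda>f. pd i (f * g)" "\<lambda>f. f * pd i g + g * pd i f"])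
    fix m :: "nat \<Rightarrow>\<^sub>0 nat" and a :: real
    let ?s = "Poly_Mapping.single m a"
    show "pd i (?s * g) = ?s * pd i g + g * pd i ?s"
      by (rule additive_mpol_eqI[of "\<lambda>g. pd i (?s * g)" "\<lambda>g. ?s * pd i g + g * pd i ?s"])
        (simp_all add: Modules.additive_def pd_add distrib_left distrib_right monom)
  qed (simp_all add: Modules.additive_def pd_add distrib_left distrib_right)
qed

lemma pd_Cst [simp]: "pd i (Cst c) = 0"
  by (simp add: Cst_def pd_single)

lemma pd_Var: "pd i (Var k) = (if i = k then 1 else 0)"
  by (auto simp: Var_def pd_single lookup_single)

lemma pd_in_PolS: "f \<in> PolS l \<Longrightarrow> pd i f \<in> PolS l"
  by (induction rule: PolS_induct) (simp_all add: pd_Var pd_add pd_mult PolS_add PolS_mult)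

text \<open>The derivation with given values on the variables.\<close>

definition deriv_of :: "nat \<Rightarrow> (nat \<Rightarrow> mpol) \<Rightarrow> mpol \<Rightarrow> mpol" where
  "deriv_of l v f = (\<Sum>i\<in>{0..l}. v i * pd i f)"

lemma deriv_of_Var: "i \<le> l \<Longrightarrow> deriv_of l v (Var i) = v i"
  by (simp add: deriv_of_def pd_Var if_distrib cong: if_cong)

lemma deriv_of_in_Der:
  assumes "\<And>i. i \<le> l \<Longrightarrow> v i \<in> PolS l"
  shows "deriv_of l v \<in> Der l"
proof -
  have "deriv_of l v f \<in> PolS l" if "f \<in> PolS l" for f
    unfolding deriv_of_def using assms pd_in_PolS[OF that]
    by (intro PolS_sum PolS_mult) auto
  moreover have "deriv_of l v (f + g) = deriv_of l v f + deriv_of l v g" for f g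
    by (simp add: deriv_of_def pd_add distrib_left sum.distrib)
  moreover have mult: "deriv_of l v (f * g) = f * deriv_of l v g + g * deriv_of l v f" for f g
    by (simp add: deriv_of_def pd_mult distrib_left sum.distrib sum_distrib_left mult.left_commute)
  moreover have "deriv_of l v (Cst c * f) = Cst c * deriv_of l v f" for c f
    unfolding mult by (simp add: deriv_of_def)
  ultimately show ?thesis unfolding Der_def by blast
qed

lemma Der_add: "\<theta> \<in> Der l \<Longrightarrow> f \<in> PolS l \<Longrightarrow> g \<in> PolS l \<Longrightarrow> \<theta> (f + g) = \<theta> f + \<theta> g"
  and Der_scale: "\<theta> \<in> Der l \<Longrightarrow> f \<in> PolS l \<Longrightarrow> \<theta> (Cst c * f) = Cst c * \<theta> f"
  and Der_mult: "\<theta> \<in> Der l \<Longrightarrow> f \<in> PolS l \<Longrightarrow> g \<in> PolS l \<Longrightarrow> \<theta> (f * g) = f * \<theta> g + g * \<theta> f"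
  and Der_in_PolS: "\<theta> \<in> Der l \<Longrightarrow> f \<in> PolS l \<Longrightarrow> \<theta> f \<in> PolS l"
  by (auto simp: Der_def)

lemma Der_uminus:
  assumes "\<theta> \<in> Der l" "f \<in> PolS l"
  shows "\<theta> (- f) = - \<theta> f"
  using Der_scale[OF assms, of "- 1"] by (simp add: Cst_uminus)

lemma Der_diff:
  assumes "\<theta> \<in> Der l" "f \<in> PolS l" "g \<in> PolS l"
  shows "\<theta> (f - g) = \<theta> f - \<theta> g"
  using Der_add[OF assms(1,2) PolS_uminus[OF assms(3)]] Der_uminus[OF assms(1,3)] by simp

lemma Der_Cst:
  assumes "\<theta> \<in> Der l"
  shows "\<theta> (Cst c) = 0"
proof -
  have "\<theta> 1 = 0" using Der_mult[OF assms PolS_1 PolS_1] by simp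
  then show ?thesis using Der_scale[OF assms PolS_1, of c] by simp
qed

lemma Der_eq_deriv_of:
  assumes "\<theta> \<in> Der l" "f \<in> PolS l"
  shows "\<theta> f = deriv_of l (\<lambda>i. \<theta> (Var i)) f"
  using assms(2)
proof (induction rule: PolS_induct)
  case (Cst c)
  then show ?case by (simp add: Der_Cst[OF assms(1)] deriv_of_def)
next
  case (Var i)
  then show ?case by (simp add: deriv_of_Var)
next
  case (add f g)
  then show ?case
    using Der_add[OF assms(1)] by (simp add: deriv_of_def pd_add distrib_left sum.distrib)
next
  case (mult f g)
  then show ?case
    using Der_mult[OF assms(1) mult.hyps]
    by (simp add: deriv_of_def pd_mult distrib_left sum.distrib sum_distrib_left mult.left_commute)
qed

lemma theta_E_eq_deriv_of: "theta_E l = deriv_of l Var"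
  by (simp add: fun_eq_iff theta_E_def deriv_of_def sum.atLeast_Suc_atMost)

lemma phi_B_eq_deriv_of:
  "phi_B l j = deriv_of l (\<lambda>i. if i = 0 then 0 else (- 1) ^ j * shi_fun l j (Var i))"
proof -
  have "phi_B l j f = (\<Sum>i=1..l. (if i = 0 then 0 else (- 1) ^ j * shi_fun l j (Var i)) * pd i f)" for f
    unfolding phi_B_def phi_coeff_eq_shi_fun sum_distrib_left
    by (intro sum.cong) (auto simp: mult.assoc)
  then show ?thesis
    by (simp add: fun_eq_iff deriv_of_def sum.atLeast_Suc_atMost)
qed

lemma signed_Der:
  assumes "\<theta> \<in> Der l" "\<bar>c\<bar> \<le> int l"
  shows "\<theta> (signed Var c) = signed (\<lambda>i. \<theta> (Var i)) c"
  using Der_uminus[OF assms(1) PolS_Var[of "nat \<bar>c\<bar>" l]] Der_Cst[OF assms(1), of 0] assms(2)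
  by (auto simp: signed_def)

lemma Der_shi_form:
  assumes "\<theta> \<in> Der l" "(p, c, e) \<in> shi_index l"
  shows "\<theta> (shi_form (p, c, e)) = \<theta> (Var p) - signed (\<lambda>i. \<theta> (Var i)) c - (if e then \<theta> Zv else 0)"
proof -
  have c: "\<bar>c\<bar> \<le> int l" and p: "Var p \<in> PolS l"
    using assms(2) by (auto simp: in_shi_index_iff intro: PolS_Var)
  have s: "signed Var c \<in> PolS l"
    using c by (rule signed_in_PolS) (auto intro: PolS_Var)
  show ?thesis
    using Der_diff[OF assms(1) p s] Der_diff[OF assms(1) p PolS_add[OF s PolS_Var[of 0]]]
      Der_add[OF assms(1) s PolS_Var[of 0]] signed_Der[OF assms(1) c]
    by (simp add: shi_form_def shi_shift_def)
qed

lemma shi_form_roots: "(\<Union>\<alpha>\<in>pos_roots_B l. {\<alpha>, \<alpha> - Zv}) = shi_form ` shi_index l"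
proof (intro equalityI subsetI)
  fix f assume "f \<in> (\<Union>\<alpha>\<in>pos_roots_B l. {\<alpha>, \<alpha> - Zv})"
  then obtain \<alpha> where \<alpha>: "\<alpha> \<in> pos_roots_B l" "f = \<alpha> \<or> f = \<alpha> - Zv" by blast
  define e where "e = (f \<noteq> \<alpha>)"
  have f: "f = \<alpha> - (if e then Zv else 0)" using \<alpha>(2) by (auto simp: e_def)
  from \<alpha>(1) obtain p c where "(p, c, e) \<in> shi_index l" "\<alpha> = Var p - signed Var c"
  proof -
    consider i where "1 \<le> i" "i \<le> l" "\<alpha> = Var i"
      | p q where "1 \<le> p" "p < q" "q \<le> l" "\<alpha> = Var p + Var q"
      | p q where "1 \<le> p" "p < q" "q \<le> l" "\<alpha> = Var p - Var q"
      using \<alpha>(1) unfolding pos_roots_B_def by blast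
    then show thesis
    proof cases
      case 1
      then show ?thesis by (intro that[of i 0]) (auto simp: in_shi_index_iff signed_def)
    next
      case 2
      then show ?thesis by (intro that[of p "- int q"]) (auto simp: in_shi_index_iff signed_def)
    next
      case 3
      then show ?thesis by (intro that[of p "int q"]) (auto simp: in_shi_index_iff signed_def)
    qed
  qed
  then show "f \<in> shi_form ` shi_index l"
    by (intro image_eqI[of _ _ "(p, c, e)"]) (simp_all add: f shi_form_def shi_shift_def diff_diff_eq)
next
  fix f assume "f \<in> shi_form ` shi_index l"
  then obtain h where h: "h \<in> shi_index l" "f = shi_form h" by blast
  obtain p c e where hp: "h = (p, c, e)" by (metis prod_cases3)
  note idx = h(1)[unfolded hp] and f = h(2)[unfolded hp]
  have "Var p - signed Var c \<in> pos_roots_B l"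
  proof -
    consider "c = 0" | "c > 0" | "c < 0" by linarith
    then show ?thesis
    proof cases
      case 1
      then show ?thesis using idx by (auto simp: pos_roots_B_def signed_def in_shi_index_iff)
    next
      case 2
      then have "1 \<le> p \<and> p < nat c \<and> nat c \<le> l" using idx by (auto simp: in_shi_index_iff)
      then have "Var p - Var (nat c) \<in> pos_roots_B l" unfolding pos_roots_B_def by blast
      then show ?thesis using 2 by (simp add: signed_def)
    next
      case 3
      then have "1 \<le> p \<and> p < nat (- c) \<and> nat (- c) \<le> l" using idx by (auto simp: in_shi_index_iff)
      then have "Var p + Var (nat (- c)) \<in> pos_roots_B l" unfolding pos_roots_B_def by blast
      then show ?thesis using 3 by (simp add: signed_def)
    qed
  qed
  moreover have "f = Var p - signed Var c - (if e then Zv else 0)"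
    by (simp add: f shi_form_def shi_shift_def diff_diff_eq)
  ultimately show "f \<in> (\<Union>\<alpha>\<in>pos_roots_B l. {\<alpha>, \<alpha> - Zv})"
    by (cases e) auto
qed

lemma D_Shi_B_iff:
  assumes "\<theta> \<in> Der l"
  shows "\<theta> \<in> D_Shi_B l \<longleftrightarrow> Zv dvd \<theta> Zv \<and> (\<forall>h\<in>shi_index l. shi_form h dvd \<theta> (shi_form h))"
proof -
  have "dvdS l f (\<theta> f) \<longleftrightarrow> f dvd \<theta> f" if "f \<in> PolS l" for f
    using that Der_in_PolS[OF assms] by (intro dvdS_iff_dvd)
  then have 1: "dvdS l Zv (\<theta> Zv) \<longleftrightarrow> Zv dvd \<theta> Zv"
    and 2: "(\<forall>h\<in>shi_index l. dvdS l (shi_form h) (\<theta> (shi_form h)))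
      \<longleftrightarrow> (\<forall>h\<in>shi_index l. shi_form h dvd \<theta> (shi_form h))"
    using shi_form_in_PolS PolS_Var[of 0 l] by auto
  have "(\<forall>\<alpha>\<in>pos_roots_B l. dvdS l \<alpha> (\<theta> \<alpha>) \<and> dvdS l (\<alpha> - Zv) (\<theta> (\<alpha> - Zv)))
      \<longleftrightarrow> (\<forall>f\<in>\<Union>\<alpha>\<in>pos_roots_B l. {\<alpha>, \<alpha> - Zv}. dvdS l f (\<theta> f))"
    by auto
  also have "\<dots> \<longleftrightarrow> (\<forall>h\<in>shi_index l. shi_form h dvd \<theta> (shi_form h))"
    unfolding shi_form_roots ball_simps by (rule 2)
  finally show ?thesis
    using assms 1 by (simp add: D_Shi_B_def)
qed

lemma theta_E_Var: "i \<le> l \<Longrightarrow> theta_E l (Var i) = Var i"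
  unfolding theta_E_eq_deriv_of by (rule deriv_of_Var)

lemma theta_E_in_D_Shi_B: "theta_E l \<in> D_Shi_B l"
proof -
  have der: "theta_E l \<in> Der l"
    unfolding theta_E_eq_deriv_of by (intro deriv_of_in_Der PolS_Var)
  have "theta_E l (shi_form h) = shi_form h" if h: "h \<in> shi_index l" for h
  proof -
    obtain p c e where hp: "h = (p, c, e)" by (metis prod_cases3)
    have "p \<le> l" "nat \<bar>c\<bar> \<le> l" using h hp by (auto simp: in_shi_index_iff)
    then have "signed (\<lambda>i. theta_E l (Var i)) c = signed Var c" "theta_E l (Var p) = Var p"
      by (auto simp: signed_def theta_E_Var)
    then show ?thesis
      using Der_shi_form[OF der h[unfolded hp]] theta_E_Var[of 0]
      by (simp add: hp shi_form_def shi_shift_def diff_diff_eq)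
  qed
  then show ?thesis
    unfolding D_Shi_B_iff[OF der] using theta_E_Var[of 0] by simp
qed

lemma signed_scale: "signed (\<lambda>i. q * v i) c = q * signed v c"
  and signed_diff: "signed (\<lambda>i. v i - w i) c = signed v c - signed w c"
  by (auto simp: signed_def)

lemma phi_B_Var:
  assumes "i \<in> {1..l}"
  shows "phi_B l j (Var i) = (- 1) ^ j * shi_fun l j (Var i)"
  unfolding phi_B_eq_deriv_of using assms by (subst deriv_of_Var) auto

lemma phi_B_Zv: "phi_B l j Zv = 0"
  unfolding phi_B_eq_deriv_of by (subst deriv_of_Var) auto

lemma signed_cong:
  assumes "\<bar>c\<bar> \<le> int l" "\<And>i. i \<in> {1..l} \<Longrightarrow> v i = w i"
  shows "signed v c = signed w c"
proof -
  have "v (nat \<bar>c\<bar>) = w (nat \<bar>c\<bar>)" if "c \<noteq> 0"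
    using that assms(1) by (intro assms(2)) auto
  then show ?thesis by (auto simp: signed_def)
qed

lemma phi_B_in_D_Shi_B:
  assumes j: "j \<in> {1..l}"
  shows "phi_B l j \<in> D_Shi_B l"
proof -
  let ?v = "\<lambda>i. shi_fun l j (Var i)"
  have vec: "shi_vector l ?v" by (rule shi_vector_shi_fun[OF j])
  have der: "phi_B l j \<in> Der l"
    unfolding phi_B_eq_deriv_of using vec
    by (intro deriv_of_in_Der) (auto simp: shi_vector_def intro!: PolS_mult PolS_power PolS_uminus)
  have "shi_form h dvd phi_B l j (shi_form h)" if h: "h \<in> shi_index l" for h
  proof -
    obtain p c e where hp: "h = (p, c, e)" by (metis prod_cases3)
    have c: "\<bar>c\<bar> \<le> int l" and p: "p \<in> {1..l}" using h hp by (auto simp: in_shi_index_iff)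
    have "phi_B l j (shi_form h)
        = (- 1) ^ j * shi_fun l j (Var p) - signed (\<lambda>i. (- 1) ^ j * shi_fun l j (Var i)) c"
      using Der_shi_form[OF der h[unfolded hp]] signed_cong[OF c phi_B_Var] p
      by (simp add: hp phi_B_Zv phi_B_Var)
    also have "\<dots> = (- 1) ^ j * (?v p - signed ?v c)"
      unfolding signed_scale by (simp only: right_diff_distrib)
    finally show ?thesis
      using vec h hp unfolding shi_vector_def by auto
  qed
  then show ?thesis
    unfolding D_Shi_B_iff[OF der] by (simp add: phi_B_Zv)
qed

text \<open>Subtracting a multiple of the Euler derivation reduces to derivations that kill \<open>z\<close>.\<close>

lemma D_Shi_B_reduce:
  assumes "\<theta> \<in> D_Shi_B l"
  obtains q where "q \<in> PolS l" "\<theta> Zv = Zv * q" "shi_vector l (\<lambda>i. \<theta> (Var i) - q * Var i)"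
proof -
  have der: "\<theta> \<in> Der l" and "dvdS l Zv (\<theta> Zv)"
    using assms by (auto simp: D_Shi_B_def)
  then obtain q where q: "q \<in> PolS l" "\<theta> Zv = Zv * q" unfolding dvdS_def by blast
  have "shi_form (p, c, e) dvd \<theta> (Var p) - q * Var p - signed (\<lambda>i. \<theta> (Var i) - q * Var i) c"
    if h: "(p, c, e) \<in> shi_index l" for p c e
  proof -
    have "\<theta> (Var p) - q * Var p - signed (\<lambda>i. \<theta> (Var i) - q * Var i) c
        = \<theta> (shi_form (p, c, e)) - q * shi_form (p, c, e)"
      unfolding Der_shi_form[OF der h] signed_diff signed_scale
      by (simp add: q(2) shi_form_def shi_shift_def algebra_simps)
    moreover have "shi_form (p, c, e) dvd \<theta> (shi_form (p, c, e))"
      using assms h unfolding D_Shi_B_iff[OF der] by blast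
    ultimately show ?thesis by simp
  qed
  moreover have "\<theta> (Var i) - q * Var i \<in> PolS l" if "i \<in> {1..l}" for i
    using that by (intro PolS_diff PolS_mult q Der_in_PolS[OF der] PolS_Var) auto
  ultimately show thesis
    using that[OF q] unfolding shi_vector_def by blast
qed

section \<open>Linear independence\<close>

lemma inj_signed_Var: "inj (signed Var)"
proof (rule injI)
  fix c c' :: int
  assume eq: "signed Var c = signed Var c'"
  have coeff: "lin_coeff i (signed Var c) = lin_coeff i (signed Var c')" for i
    by (simp only: eq)
  show "c = c'"
  proof (rule ccontr)
    assume ne: "c \<noteq> c'"
    show False
    proof (cases "c = 0")
      case True
      then show False
        using coeff[of "nat \<bar>c'\<bar>"] ne by (simp add: lin_coeff_signed_Var sgn_eq_0_iff)
    next
      case False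
      then have abs: "\<bar>c\<bar> = \<bar>c'\<bar>"
        using coeff[of "nat \<bar>c\<bar>"]
        by (auto simp: lin_coeff_signed_Var sgn_eq_0_iff split: if_splits)
      then have "c' = - c" using ne by linarith
      then show False
        using coeff[of "nat \<bar>c\<bar>"] False by (simp add: lin_coeff_signed_Var sgn_eq_0_iff)
    qed
  qed
qed

lemma shi_numerator_eq_0:
  assumes "k < j" "1 \<le> k"
  shows "shi_numerator l j (Var k) b = 0"
proof -
  have "(\<Prod>t\<in>{1..<j}. (Var t - Var k) * (Var t - b)) = 0"
    using assms by (intro prod_zero) auto
  then show ?thesis by (simp add: shi_numerator_def)
qed

lemma shi_numerator_neq_0:
  assumes k: "k \<in> {1..l}"
  shows "shi_numerator l k (Var k) (Zv - Var k) \<noteq> 0"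
proof -
  let ?b = "Zv - Var k"
  have lin: "Zv - Var k + s * Var t \<noteq> 0" if "s = 1 \<or> s = - 1" "t \<noteq> 0" for s t
  proof (rule nonzero_if_lin_coeff[of 0])
    show "lin_coeff 0 (Zv - Var k + s * Var t) \<noteq> 0" using that k by auto
  qed
  have "(\<Prod>t\<in>{1..<k}. (Var t - Var k) * (Var t - ?b)) \<noteq> 0"
  proof -
    have "(Var t - Var k) * (Var t - ?b) \<noteq> 0" if "t \<in> {1..<k}" for t
    proof -
      have "Var t - Var k \<noteq> 0"
        using that by (intro nonzero_if_lin_coeff[of t]) auto
      moreover have "Var t - ?b \<noteq> 0"
        using that by (intro nonzero_if_lin_coeff[of t]) auto
      ultimately show ?thesis by simp
    qed
    then show ?thesis by (simp only: prod_zero_iff[OF finite_atLeastLessThan]) blast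
  qed
  moreover have "(\<Prod>t\<in>{k + 1..l}. ?b ^ 2 - Var t ^ 2) \<noteq> 0"
  proof -
    have "?b ^ 2 - Var t ^ 2 \<noteq> 0" if "t \<in> {k + 1..l}" for t
    proof -
      have "?b ^ 2 - Var t ^ 2 = (?b + 1 * Var t) * (?b + (- 1) * Var t)"
        by (simp add: power2_eq_square algebra_simps)
      moreover have "\<dots> \<noteq> 0"
        using that lin[of 1 t] lin[of "- 1" t] by (intro no_zero_divisors) auto
      ultimately show ?thesis by simp
    qed
    then show ?thesis by (simp only: prod_zero_iff[OF finite_atLeastAtMost]) blast
  qed
  moreover have "?b \<noteq> 0"
    using k by (intro nonzero_if_lin_coeff[of 0]) auto
  moreover have "?b - Var k \<noteq> 0"
  proof (rule nonzero_if_lin_coeff[of 0])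
    show "lin_coeff 0 (?b - Var k) \<noteq> 0" unfolding lin_coeff_simps using k by simp
  qed
  ultimately show ?thesis
    unfolding shi_numerator_def by simp
qed

text \<open>A linear combination of the functions \<open>shi_fun l j\<close> is an odd polynomial function of degree at
  most \<open>2l\<close>. If it vanishes at all \<open>x\<^sub>i\<close>, it has the \<open>2l + 1\<close> zeros \<open>0, \<plusminus>x\<^sub>i\<close> and therefore is
  identically zero, and so is its difference. At \<open>y = x\<^sub>k - z\<close> the numerator of index \<open>j\<close> vanishes
  for \<open>j > k\<close> but not for \<open>j = k\<close>, so the coefficients are zero by induction on \<open>k\<close>.\<close>

lemma shi_fun_independent:
  assumes zero: "\<And>i. i \<in> {1..l} \<Longrightarrow> (\<Sum>j\<in>{1..l}. c j * shi_fun l j (Var i)) = 0"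
    and k: "k \<in> {1..l}"
  shows "c k = 0"
proof -
  define H where "H = (\<lambda>y. \<Sum>j\<in>{1..l}. c j * shi_fun l j y)"
  have "polynomial_fun (2 * l) H"
    unfolding H_def by (intro polynomial_fun_sum polynomial_fun_cmult polynomial_fun_shi_fun)
  then obtain P where P: "degree P \<le> 2 * l" "\<And>y. poly P y = H y"
    unfolding polynomial_fun_def by blast
  have odd: "H 0 = 0" "H (- y) = - H y" for y
    unfolding H_def by (simp_all add: shi_fun_zero shi_fun_uminus sum_negf)
  have "P = 0"
  proof (rule ccontr)
    assume "P \<noteq> 0"
    let ?R = "signed Var ` {- int l..int l}"
    have "H (signed Var i) = 0" if "i \<in> {- int l..int l}" for i
    proof -
      have "H (Var (nat \<bar>i\<bar>)) = 0" if "i \<noteq> 0"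
        unfolding H_def using that \<open>i \<in> {- int l..int l}\<close> by (intro zero) auto
      then show ?thesis by (auto simp: signed_def odd)
    qed
    then have "?R \<subseteq> {y. poly P y = 0}" by (auto simp: P(2))
    then have "card ?R \<le> card {y. poly P y = 0}"
      using poly_roots_finite[OF \<open>P \<noteq> 0\<close>] by (intro card_mono)
    also have "\<dots> \<le> 2 * l"
      using card_poly_roots_bound[OF \<open>P \<noteq> 0\<close>] P(1) by linarith
    finally show False
      using card_image[OF inj_on_subset[OF inj_signed_Var], of "{- int l..int l}"] by simp
  qed
  then have H0: "H y = 0" for y using P(2)[of y] by simp
  show ?thesis
    using k
  proof (induction k rule: less_induct)
    case (less k)
    let ?y = "Var k - Zv" and ?b = "Zv - Var k"
    have "0 = (Var k - ?b) * (H (?y + Zv) - H ?y)"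
      by (simp add: H0)
    also have "\<dots> = (\<Sum>j\<in>{1..l}. c j * ((Var k - ?b) * (shi_fun l j (?y + Zv) - shi_fun l j ?y)))"
      unfolding H_def sum_subtractf[symmetric] sum_distrib_left
      by (simp only: right_diff_distrib mult.left_commute)
    also have "\<dots> = (\<Sum>j\<in>{1..l}. c j * (Zv * shi_numerator l j (Var k) ?b))"
      by (intro sum.cong refl) (subst shi_fun_difference, auto)
    also have "\<dots> = (\<Sum>j\<in>{k}. c j * (Zv * shi_numerator l j (Var k) ?b))"
    proof (rule sum.mono_neutral_right)
      show "\<forall>j\<in>{1..l} - {k}. c j * (Zv * shi_numerator l j (Var k) ?b) = 0"
      proof
        fix j assume j: "j \<in> {1..l} - {k}"
        show "c j * (Zv * shi_numerator l j (Var k) ?b) = 0"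
        proof (cases "j < k")
          case True
          then show ?thesis using less.IH[of j] j by simp
        next
          case False
          then show ?thesis using shi_numerator_eq_0[of k j] j less.prems by simp
        qed
      qed
    qed (use less.prems in auto)
    finally have "c k * (Zv * shi_numerator l k (Var k) ?b) = 0" by simp
    moreover have "Zv \<noteq> 0"
      by (rule nonzero_if_lin_coeff[of 0]) simp
    ultimately show ?case
      using shi_numerator_neq_0[OF less.prems] by simp
  qed
qed


section \<open>Homogeneity\<close>

text \<open>Homogeneity of degree \<open>n\<close>, tested by scaling all variables by the variable \<open>Var N\<close>.\<close>

definition homogeneous :: "nat \<Rightarrow> nat \<Rightarrow> mpol \<Rightarrow> bool" where
  "homogeneous N n f \<longleftrightarrow> subst_var (\<lambda>i. Var N * Var i) f = Var N ^ n * f"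

lemma homogeneous_0: "homogeneous N n 0"
  and homogeneous_1: "homogeneous N 0 1"
  and homogeneous_Cst: "homogeneous N 0 (Cst c)"
  and homogeneous_Var: "homogeneous N 1 (Var i)"
  by (simp_all add: homogeneous_def)

lemma homogeneous_add: "homogeneous N n f \<Longrightarrow> homogeneous N n g \<Longrightarrow> homogeneous N n (f + g)"
  and homogeneous_diff: "homogeneous N n f \<Longrightarrow> homogeneous N n g \<Longrightarrow> homogeneous N n (f - g)"
  and homogeneous_uminus: "homogeneous N n f \<Longrightarrow> homogeneous N n (- f)"
  by (simp_all add: homogeneous_def subst_var_simps algebra_simps)

lemma homogeneous_mult:
  "homogeneous N n f \<Longrightarrow> homogeneous N n' g \<Longrightarrow> homogeneous N (n + n') (f * g)"
  by (simp add: homogeneous_def subst_var_mult power_add algebra_simps)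

lemma homogeneous_sum:
  "(\<And>i. i \<in> A \<Longrightarrow> homogeneous N n (f i)) \<Longrightarrow> homogeneous N n (\<Sum>i\<in>A. f i)"
  by (induction A rule: infinite_finite_induct) (auto intro: homogeneous_0 homogeneous_add)

lemma homogeneous_prod:
  assumes "finite A" "\<And>i. i \<in> A \<Longrightarrow> homogeneous N n (f i)"
  shows "homogeneous N (n * card A) (\<Prod>i\<in>A. f i)"
  using assms by (induction A) (auto intro: homogeneous_1 homogeneous_mult)

lemma homogeneous_power: "homogeneous N n f \<Longrightarrow> homogeneous N (n * k) (f ^ k)"
  using homogeneous_prod[of "{..<k}" N n "\<lambda>_. f"] by simp

lemma homogeneous_esym:
  assumes "finite A" "\<And>i. i \<in> A \<Longrightarrow> homogeneous N n (f i)"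
  shows "homogeneous N (n * k) (esym k f A)"
  unfolding esym_def
proof (intro homogeneous_sum)
  fix K assume "K \<in> {K. K \<subseteq> A \<and> card K = k}"
  then show "homogeneous N (n * k) (\<Prod>i\<in>K. f i)"
    using homogeneous_prod[of K N n f] finite_subset[OF _ assms(1)] assms(2) by auto
qed

lemma homogeneous_bern_hom: "homogeneous N (r + 2 * s) (bern_hom r s (Var i) Zv)"
  unfolding bern_hom_def
proof (intro homogeneous_sum)
  fix k assume "k \<in> {..r + 2 * s}"
  then have "0 + 1 * k + 1 * (r + 2 * s - k) = r + 2 * s" by simp
  then show "homogeneous N (r + 2 * s)
      (Cst (coeff (bern_B r s) k) * Var i ^ k * Zv ^ (r + 2 * s - k))"
    using homogeneous_mult[OF homogeneous_mult[OF homogeneous_Cst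
        homogeneous_power[OF homogeneous_Var]] homogeneous_power[OF homogeneous_Var]] by metis
qed

lemma homogeneous_shi_fun:
  assumes j: "j \<in> {1..l}"
  shows "homogeneous N (2 * l) (shi_fun l j (Var i))"
  unfolding shi_fun_def
proof (intro homogeneous_sum, clarify)
  fix N1 N2 assume N: "N1 \<subseteq> {1..<j}" "N2 \<subseteq> {1..<j}" "N1 \<inter> N2 = {}"
  let ?s = "(j - 1) - card N1 - card N2"
  let ?r = "\<lambda>k2 k3. 2 * l + 2 - 2 * j - k2 - 2 * k3"
  let ?m = "2 * l + 2 - 2 * j + 2 * ?s"
  have fin: "finite N1" "finite N2" using N finite_subset[OF _ finite_atLeastLessThan] by blast+
  have "card N1 + card N2 \<le> j - 1"
    using card_mono[of "{1..<j}" "N1 \<union> N2"] N fin by (simp add: card_Un_disjoint)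
  then have deg: "2 * card N1 + 2 * card N2 + ?m = 2 * l"
    using j by auto
  have h1: "homogeneous N (2 * card N1) (\<Prod>t\<in>N1. Var t ^ 2)"
    using fin homogeneous_power[OF homogeneous_Var, of N 2] by (intro homogeneous_prod) auto
  have h2: "homogeneous N (2 * card N2) (\<Prod>t\<in>N2. - (Var t * Zv))"
    using fin homogeneous_mult[OF homogeneous_Var homogeneous_Var, of N]
    by (intro homogeneous_prod homogeneous_uminus) (auto simp: numeral_2_eq_2)
  have h3: "homogeneous N ?m (\<Sum>k2\<in>{0..1}. \<Sum>k3\<in>{0..l - j}. (- 1) ^ (k2 + k3)
      * esym k2 Var {j} * esym k3 (\<lambda>t. Var t ^ 2) {j + 1..l} * bern_hom (?r k2 k3) ?s (Var i) Zv)"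
  proof (intro homogeneous_sum)
    fix k2 k3 :: nat assume k: "k2 \<in> {0..1}" "k3 \<in> {0..l - j}"
    have 1: "homogeneous N 0 ((- 1) ^ (k2 + k3))"
      using homogeneous_power[OF homogeneous_uminus[OF homogeneous_1], of N "k2 + k3"] by simp
    have 2: "homogeneous N (1 * k2) (esym k2 Var {j})"
      by (intro homogeneous_esym homogeneous_Var) auto
    have 3: "homogeneous N (2 * k3) (esym k3 (\<lambda>t. Var t ^ 2) {j + 1..l})"
      using homogeneous_power[OF homogeneous_Var, of N 2] by (intro homogeneous_esym) auto
    have deg': "0 + 1 * k2 + 2 * k3 + (?r k2 k3 + 2 * ?s) = ?m"
      using k j by auto
    show "homogeneous N ?m ((- 1) ^ (k2 + k3) * esym k2 Var {j}
        * esym k3 (\<lambda>t. Var t ^ 2) {j + 1..l} * bern_hom (?r k2 k3) ?s (Var i) Zv)"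
      using homogeneous_mult[OF homogeneous_mult[OF homogeneous_mult[OF 1 2] 3]
          homogeneous_bern_hom[of N "?r k2 k3" ?s i]] by (simp only: deg')
  qed
  show "homogeneous N (2 * l) ((\<Prod>t\<in>N1. Var t ^ 2) * (\<Prod>t\<in>N2. - (Var t * Zv))
      * (\<Sum>k2\<in>{0..1}. \<Sum>k3\<in>{0..l - j}. (- 1) ^ (k2 + k3)
      * esym k2 Var {j} * esym k3 (\<lambda>t. Var t ^ 2) {j + 1..l} * bern_hom (?r k2 k3) ?s (Var i) Zv))"
    using homogeneous_mult[OF homogeneous_mult[OF h1 h2] h3] by (simp only: deg)
qed

lemma homogeneous_shi_form: "homogeneous N 1 (shi_form h)"
proof -
  have "homogeneous N 1 (signed Var c)" for c
    by (simp add: signed_def homogeneous_0 homogeneous_uminus homogeneous_Var[unfolded One_nat_def])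
  then show ?thesis
    unfolding shi_form_def shi_shift_def case_prod_beta
    by (intro homogeneous_diff homogeneous_add homogeneous_Var) (auto intro: homogeneous_0 homogeneous_Var[unfolded One_nat_def])
qed

lemma subst_var_subst_var: "subst_var \<tau> (subst_var \<sigma> f) = subst_var (\<lambda>i. subst_var \<tau> (\<sigma> i)) f"
proof -
  obtain l where "f \<in> PolS l" using ex_PolS by blast
  then show ?thesis by (induction rule: PolS_induct) (simp_all add: subst_var_simps)
qed

lemma subst_var_zero: "\<exists>c. subst_var (\<lambda>_. 0) f = Cst c"
proof -
  obtain l where "f \<in> PolS l" using ex_PolS by blast
  then show ?thesis
  proof (induction rule: PolS_induct)
    case (Var i)
    show ?case by (intro exI[of _ 0]) simp
  next
    case (add f g)
    then show ?case by (metis subst_var_add Cst_add)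
  next
    case (mult f g)
    then show ?case by (metis subst_var_mult Cst_mult)
  qed auto
qed

text \<open>Scaling by a new variable and setting this variable to 0 leaves only the constant term.\<close>

lemma homogeneous_degree_0:
  assumes "f \<in> PolS l" "homogeneous (Suc l) 0 f"
  shows "\<exists>c. f = Cst c"
proof -
  have "f = subst_var (Var(Suc l := 0)) f"
    using assms(1) by (intro subst_var_id[symmetric]) auto
  also have "\<dots> = subst_var (Var(Suc l := 0)) (subst_var (\<lambda>i. Var (Suc l) * Var i) f)"
    using assms(2) by (simp add: homogeneous_def)
  also have "\<dots> = subst_var (\<lambda>_. 0) f"
    unfolding subst_var_subst_var by (simp add: subst_var_mult)
  finally show ?thesis using subst_var_zero[of f] by metis
qed

lemma homogeneous_cancel:
  assumes "homogeneous N m f" "homogeneous N (m + n) (f * g)" "f \<noteq> 0"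
  shows "homogeneous N n g"
proof -
  have "Var N \<noteq> 0" by (rule nonzero_if_lin_coeff[of N]) simp
  moreover have "(Var N ^ m * f) * subst_var (\<lambda>i. Var N * Var i) g = (Var N ^ m * f) * (Var N ^ n * g)"
    using assms(1,2) by (simp add: homogeneous_def subst_var_mult power_add algebra_simps)
  ultimately show ?thesis
    using assms(3) by (simp add: homogeneous_def)
qed

section \<open>Determinants and spanning\<close>

text \<open>Modulo the linear form of index \<open>(p, c, e)\<close> the rows of index \<open>p\<close> and \<open>\<bar>c\<bar>\<close> of a matrix whose
  columns are Shi vectors are linearly dependent, so the form divides the determinant. The linear
  forms are pairwise coprime, hence their product divides it.\<close>

lemma prod_shi_form_dvd_det:
  assumes "\<And>j. j < l \<Longrightarrow> shi_vector l (v j)"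
  shows "(\<Prod>h\<in>shi_index l. shi_form h) dvd det (mat l l (\<lambda>(i, j). v j (Suc i)))"
proof (rule prod_shi_form_dvd[OF subset_refl finite_shi_index])
  fix h assume "h \<in> shi_index l"
  moreover obtain p c e where hp: "h = (p, c, e)" by (metis prod_cases3)
  ultimately have idx: "(p, c, e) \<in> shi_index l" by simp
  let ?s = "subst_var (Var(p := shi_shift c e))"
  let ?M = "mat l l (\<lambda>(i, j). v j (Suc i))"
  interpret s: comm_ring_hom ?s by (rule comm_ring_hom_subst_var)
  define w where "w = vec l (\<lambda>i. (if Suc i = p then 1 else 0)
      - (if c \<noteq> 0 \<and> Suc i = nat \<bar>c\<bar> then (if c > 0 then 1 else - 1) else 0 :: mpol))"
  have p: "1 \<le> p" "p \<le> l" "c \<noteq> 0 \<Longrightarrow> nat \<bar>c\<bar> \<in> {p + 1..l}"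
    using idx by (auto simp: in_shi_index_iff)
  have "w $ (p - 1) = 1"
    using p by (auto simp: w_def)
  then have "w \<noteq> 0\<^sub>v l" using p by auto
  moreover have "transpose_mat (map_mat ?s ?M) *\<^sub>v w = 0\<^sub>v l"
  proof (rule eq_vecI)
    fix j assume "j < dim_vec (0\<^sub>v l :: mpol vec)"
    then have j: "j < l" by simp
    let ?u = "\<lambda>i. ?s (v j i)"
    have "(transpose_mat (map_mat ?s ?M) *\<^sub>v w) $ j = (\<Sum>i\<in>{0..<l}. ?u (Suc i) * w $ i)"
      using j by (simp add: scalar_prod_def w_def)
    also have "\<dots> = (\<Sum>i\<in>{0..<l}. (if i = p - 1 then ?u p else 0)
        - (if i = nat \<bar>c\<bar> - 1 then signed ?u c else 0))"
    proof (rule sum.cong[OF refl])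
      fix i assume "i \<in> {0..<l}"
      moreover have "Suc i = p \<longleftrightarrow> i = p - 1"
        using p(1) by auto
      moreover have "c \<noteq> 0 \<and> Suc i = nat \<bar>c\<bar> \<longleftrightarrow> c \<noteq> 0 \<and> i = nat \<bar>c\<bar> - 1"
        using p(3) by auto
      ultimately have w: "w $ i = (if i = p - 1 then 1 else 0)
          - (if c \<noteq> 0 \<and> i = nat \<bar>c\<bar> - 1 then (if c > 0 then 1 else - 1) else 0)"
        unfolding w_def by (subst index_vec) (simp_all only: atLeastLessThan_iff)
      have 1: "?u (Suc i) * (if i = p - 1 then 1 else 0) = (if i = p - 1 then ?u p else 0)"
        using p(1) by simp
      have 2: "?u (Suc i) * (if c \<noteq> 0 \<and> i = nat \<bar>c\<bar> - 1 then (if c > 0 then 1 else - 1) else 0)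
          = (if i = nat \<bar>c\<bar> - 1 then signed ?u c else 0)"
      proof (cases "c \<noteq> 0 \<and> i = nat \<bar>c\<bar> - 1")
        case True
        then have "Suc i = nat \<bar>c\<bar>" by simp
        then show ?thesis using True by (auto simp: signed_def)
      qed (auto simp: signed_def)
      show "?u (Suc i) * w $ i = (if i = p - 1 then ?u p else 0)
          - (if i = nat \<bar>c\<bar> - 1 then signed ?u c else 0)"
        unfolding w right_diff_distrib 1 2 ..
    qed
    also have "\<dots> = ?u p - signed ?u c"
    proof -
      have "p - 1 < l" using p by auto
      moreover have "nat \<bar>c\<bar> - 1 < l"
      proof (cases "c = 0")
        case False
        then show ?thesis using p(3)[OF False] by (cases "nat \<bar>c\<bar>") auto
      qed (use p in simp)
      ultimately show ?thesis by (simp add: sum_subtractf)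
    qed
    also have "\<dots> = ?s (v j p - signed (v j) c)"
      by (auto simp: signed_def subst_var_diff subst_var_uminus)
    also have "\<dots> = 0"
      using assms[OF j] idx shi_form_dvd_iff[OF idx] unfolding shi_vector_def by auto
    finally show "(transpose_mat (map_mat ?s ?M) *\<^sub>v w) $ j = 0\<^sub>v l $ j" using j by simp
  qed simp
  ultimately have "det (transpose_mat (map_mat ?s ?M)) = 0"
    by (intro det_0_iff_vec_prod_zero[of _ l, THEN iffD2] exI[of _ w]) (simp_all add: w_def)
  then have "?s (det ?M) = 0"
    by (simp add: det_transpose[of _ l] s.hom_det)
  then show "shi_form h dvd det ?M"
    unfolding hp shi_form_dvd_iff[OF idx] .
qed

text \<open>The matrix of the values of \<open>phi_B l 1, \<dots>, phi_B l l\<close> (columns) at \<open>x\<^sub>1, \<dots>, x\<^sub>l\<close> (rows), up to the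
  signs of the columns. Rows and columns are counted from 0.\<close>

definition shi_matrix :: "nat \<Rightarrow> mpol mat" where
  "shi_matrix l = mat l l (\<lambda>(i, j). shi_fun l (Suc j) (Var (Suc i)))"

lemma shi_matrix_carrier [simp]: "shi_matrix l \<in> carrier_mat l l"
  and dim_shi_matrix [simp]: "dim_row (shi_matrix l) = l" "dim_col (shi_matrix l) = l"
  by (simp_all add: shi_matrix_def)

lemma shi_matrix_mult_vec:
  assumes "x \<in> carrier_vec l" "i < l"
  shows "(shi_matrix l *\<^sub>v x) $ i = (\<Sum>j\<in>{1..l}. x $ (j - 1) * shi_fun l j (Var (Suc i)))"
proof -
  have "(shi_matrix l *\<^sub>v x) $ i = (\<Sum>j\<in>{0..<l}. shi_fun l (Suc j) (Var (Suc i)) * x $ j)"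
    using assms by (simp add: shi_matrix_def scalar_prod_def)
  also have "\<dots> = (\<Sum>j\<in>{1..l}. x $ (j - 1) * shi_fun l j (Var (Suc i)))"
    by (rule sum.reindex_bij_witness[of _ "\<lambda>j. j - 1" Suc]) (auto simp: mult.commute)
  finally show ?thesis .
qed

lemma det_shi_matrix_neq_0: "det (shi_matrix l) \<noteq> 0"
proof
  assume "det (shi_matrix l) = 0"
  then obtain x where x: "x \<in> carrier_vec l" "x \<noteq> 0\<^sub>v l" "shi_matrix l *\<^sub>v x = 0\<^sub>v l"
    using det_0_iff_vec_prod_zero[OF shi_matrix_carrier] by blast
  have "x $ (k - 1) = 0" if k: "k \<in> {1..l}" for k
  proof (rule shi_fun_independent[OF _ k])
    fix i assume i: "i \<in> {1..l}"
    then have "i - 1 < l" "Suc (i - 1) = i" by auto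
    then show "(\<Sum>j\<in>{1..l}. x $ (j - 1) * shi_fun l j (Var i)) = 0"
      using shi_matrix_mult_vec[OF x(1), of "i - 1"] unfolding x(3) by simp
  qed
  then have "x $ k = 0" if "k < l" for k
    using that by (metis Suc_leI atLeastAtMost_iff diff_Suc_1 le_add1 plus_1_eq_Suc)
  then have "x = 0\<^sub>v l" using x(1) by (intro eq_vecI) auto
  then show False using x(2) by simp
qed

text \<open>The product of the \<open>2l\<^sup>2\<close> linear forms divides the determinant, and both are homogeneous of
  degree \<open>2l\<^sup>2\<close>, so the quotient is a constant.\<close>

lemma det_shi_matrix:
  "\<exists>c. c \<noteq> 0 \<and> det (shi_matrix l) = Cst c * (\<Prod>h\<in>shi_index l. shi_form h)"
proof -
  let ?Q = "\<Prod>h\<in>shi_index l. shi_form h" and ?T = "Var (Suc l)"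
  let ?\<rho> = "\<lambda>i. Var (Suc l) * Var i"
  let ?\<kappa> = "\<lambda>i. if i \<le> l then Var i else 0"
  have "?Q dvd det (shi_matrix l)"
    unfolding shi_matrix_def by (rule prod_shi_form_dvd_det, rule shi_vector_shi_fun) auto
  then obtain h where h: "det (shi_matrix l) = ?Q * h" ..
  have Q: "?Q \<noteq> 0" using h det_shi_matrix_neq_0[of l] by auto
  interpret \<rho>: comm_ring_hom "subst_var ?\<rho>" by (rule comm_ring_hom_subst_var)
  interpret \<kappa>: comm_ring_hom "subst_var ?\<kappa>" by (rule comm_ring_hom_subst_var)
  have "map_mat (subst_var ?\<kappa>) (shi_matrix l) = shi_matrix l"
    by (rule eq_matI) (auto simp: shi_matrix_def intro!: subst_var_id shi_fun_in_PolS PolS_Var)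
  then have "subst_var ?\<kappa> (?Q * h) = ?Q * h"
    unfolding h[symmetric] \<kappa>.hom_det[symmetric] by (rule arg_cong)
  moreover have "subst_var ?\<kappa> ?Q = ?Q"
    by (intro subst_var_id PolS_prod shi_form_in_PolS) auto
  ultimately have "?Q * subst_var ?\<kappa> h = ?Q * h" by (simp only: subst_var_mult)
  then have "subst_var ?\<kappa> h = h" using Q by simp
  moreover have "subst_var ?\<kappa> h \<in> PolS l"
    by (intro subst_var_in_PolS) (auto intro: PolS_Var)
  ultimately have hS: "h \<in> PolS l" by simp
  have "map_mat (subst_var ?\<rho>) (shi_matrix l) = ?T ^ (2 * l) \<cdot>\<^sub>m shi_matrix l"
    using homogeneous_shi_fun by (intro eq_matI) (auto simp: shi_matrix_def homogeneous_def)
  then have "subst_var ?\<rho> (det (shi_matrix l)) = (?T ^ (2 * l)) ^ l * det (shi_matrix l)"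
    unfolding \<rho>.hom_det[symmetric] by (simp only: det_smult dim_shi_matrix)
  then have Qh: "homogeneous (Suc l) (2 * l * l + 0) (?Q * h)"
    by (simp add: homogeneous_def h power_mult)
  have "homogeneous (Suc l) (1 * card (shi_index l)) ?Q"
    by (intro homogeneous_prod finite_shi_index homogeneous_shi_form)
  then have "homogeneous (Suc l) (2 * l * l) ?Q"
    by (simp only: card_shi_index nat_mult_1)
  then have "homogeneous (Suc l) 0 h"
    using Qh Q by (rule homogeneous_cancel)
  then obtain c where c: "h = Cst c"
    using homogeneous_degree_0[OF hS] by blast
  have "c \<noteq> 0"
    using det_shi_matrix_neq_0[of l] unfolding h c by (metis Cst_0 mult_zero_right)
  moreover have "det (shi_matrix l) = Cst c * ?Q"
    unfolding h c by (rule mult.commute)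
  ultimately show ?thesis by blast
qed

lemma det_replace_col_smult:
  fixes A :: "'a::comm_ring_1 mat"
  assumes A: "A \<in> carrier_mat n n" and b: "b \<in> carrier_vec n" and k: "k < n"
  shows "det (replace_col A (d \<cdot>\<^sub>v b) k) = d * det (replace_col A b k)"
proof -
  have car: "replace_col A x k \<in> carrier_mat n n" for x
    using A by (simp add: replace_col_def)
  have "transpose_mat (replace_col A (d \<cdot>\<^sub>v b) k) = multrow k d (transpose_mat (replace_col A b k))"
    using A b by (intro eq_matI) (auto simp: replace_col_def)
  then have "det (transpose_mat (replace_col A (d \<cdot>\<^sub>v b) k)) = d * det (transpose_mat (replace_col A b k))"
    using det_multrow[OF k, of "transpose_mat (replace_col A b k)" d] car[of b] by simp
  then show ?thesis by (simp add: det_transpose[OF car])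
qed

text \<open>Cramer's rule: the numerators are determinants of matrices of Shi vectors, and these are
  divisible by the determinant of the matrix itself, as it is a constant multiple of the product of
  the linear forms.\<close>

lemma shi_vector_spanned:
  assumes v: "shi_vector l v"
  shows "\<exists>w. (\<forall>j\<in>{1..l}. w j \<in> PolS l) \<and> (\<forall>i\<in>{1..l}. v i = (\<Sum>j\<in>{1..l}. w j * shi_fun l j (Var i)))"
proof -
  let ?Q = "\<Prod>h\<in>shi_index l. shi_form h" and ?A = "shi_matrix l"
  let ?\<kappa> = "\<lambda>i. if i \<le> l then Var i else 0"
  obtain c where c: "c \<noteq> 0" "det ?A = Cst c * ?Q" using det_shi_matrix by blast
  have D: "det ?A \<noteq> 0" by (rule det_shi_matrix_neq_0)
  define b where "b = vec l (\<lambda>i. v (Suc i))"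
  have b: "b \<in> carrier_vec l" by (simp add: b_def)
  define x where "x = adj_mat ?A *\<^sub>v b"
  note adj = adj_mat[OF shi_matrix_carrier[of l]]
  have x: "x \<in> carrier_vec l" unfolding x_def using adj(1) b by simp
  have Ax: "?A *\<^sub>v x = det ?A \<cdot>\<^sub>v b"
  proof -
    have "?A *\<^sub>v x = (?A * adj_mat ?A) *\<^sub>v b"
      unfolding x_def by (rule assoc_mult_mat_vec[symmetric, OF shi_matrix_carrier adj(1) b])
    then show ?thesis
      unfolding adj(2) using b by (intro eq_vecI) (auto simp: smult_scalar_prod_distrib[of _ l])
  qed
  have "?Q dvd x $ k" if k: "k < l" for k
  proof -
    have "det ?A * det (replace_col ?A b k) = x $ k * det ?A"
      using cramer_lemma_mat[OF shi_matrix_carrier x k]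
      unfolding Ax det_replace_col_smult[OF shi_matrix_carrier b k] .
    then have "det ?A * x $ k = det ?A * det (replace_col ?A b k)"
      by (rule trans[OF mult.commute sym])
    then have "x $ k = det (replace_col ?A b k)"
      by (simp only: mult_left_cancel[OF D])
    also have "replace_col ?A b k
        = mat l l (\<lambda>(i, j). (if j = k then v else (\<lambda>i. shi_fun l (Suc j) (Var i))) (Suc i))"
      by (intro eq_matI) (auto simp: replace_col_def shi_matrix_def b_def)
    finally have "x $ k
        = det (mat l l (\<lambda>(i, j). (if j = k then v else (\<lambda>i. shi_fun l (Suc j) (Var i))) (Suc i)))" .
    then show ?thesis
      using v shi_vector_shi_fun
      by (simp only:) (intro prod_shi_form_dvd_det[of l "\<lambda>j. if j = k then v else (\<lambda>i. shi_fun l (Suc j) (Var i))"], auto)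
  qed
  then have "\<forall>k. \<exists>g. k < l \<longrightarrow> x $ k = ?Q * g" by (meson dvdE)
  then obtain g where g: "\<And>k. k < l \<Longrightarrow> x $ k = ?Q * g k" by metis
  define w where "w = (\<lambda>j. Cst (inverse c) * g (j - 1))"
  have w: "v i = (\<Sum>j\<in>{1..l}. w j * shi_fun l j (Var i))" if i: "i \<in> {1..l}" for i
  proof -
    have i': "i - 1 < l" "Suc (i - 1) = i" using i by auto
    have Q: "?Q \<noteq> 0" using c D by auto
    have "?Q * (Cst c * v i) = (?A *\<^sub>v x) $ (i - 1)"
      unfolding Ax c(2) using b i' by (simp add: b_def)
    also have "\<dots> = (\<Sum>j\<in>{1..l}. x $ (j - 1) * shi_fun l j (Var i))"
      using shi_matrix_mult_vec[OF x i'(1)] i'(2) by simp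
    also have "\<dots> = ?Q * (\<Sum>j\<in>{1..l}. g (j - 1) * shi_fun l j (Var i))"
      unfolding sum_distrib_left by (intro sum.cong refl) (auto simp: g)
    finally have "Cst c * v i = (\<Sum>j\<in>{1..l}. g (j - 1) * shi_fun l j (Var i))"
      using Q by simp
    then have "Cst (inverse c) * (Cst c * v i) = (\<Sum>j\<in>{1..l}. w j * shi_fun l j (Var i))"
      by (simp add: w_def sum_distrib_left mult.assoc)
    moreover have "Cst (inverse c) * Cst c = 1"
      using c(1) by (simp flip: Cst_mult)
    ultimately show ?thesis by (simp flip: mult.assoc)
  qed
  \<comment> \<open>The coefficients may be taken in the ring in \<open>z, x\<^sub>1, \<dots>, x\<^sub>l\<close>, by setting the other variables to 0.\<close>
  have "v i = (\<Sum>j\<in>{1..l}. subst_var ?\<kappa> (w j) * shi_fun l j (Var i))" if i: "i \<in> {1..l}" for i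
  proof -
    have "v i = subst_var ?\<kappa> (v i)"
      using v i unfolding shi_vector_def by (intro subst_var_id[symmetric]) auto
    also have "\<dots> = (\<Sum>j\<in>{1..l}. subst_var ?\<kappa> (w j) * subst_var ?\<kappa> (shi_fun l j (Var i)))"
      unfolding w[OF i] by (simp only: subst_var_sum subst_var_mult)
    also have "\<dots> = (\<Sum>j\<in>{1..l}. subst_var ?\<kappa> (w j) * shi_fun l j (Var i))"
    proof (intro sum.cong refl)
      fix j assume "j \<in> {1..l}"
      then have "subst_var ?\<kappa> (shi_fun l j (Var i)) = shi_fun l j (Var i)"
        using i by (intro subst_var_id[of _ l] shi_fun_in_PolS PolS_Var) auto
      then show "subst_var ?\<kappa> (w j) * subst_var ?\<kappa> (shi_fun l j (Var i))
          = subst_var ?\<kappa> (w j) * shi_fun l j (Var i)" by simp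
    qed
    finally show ?thesis .
  qed
  moreover have "subst_var ?\<kappa> (w j) \<in> PolS l" for j
    by (intro subst_var_in_PolS) (auto intro: PolS_Var)
  ultimately show ?thesis by (intro exI[of _ "\<lambda>j. subst_var ?\<kappa> (w j)"]) blast
qed


section \<open>The basis of the derivation module\<close>

lemma shi_basis_sum:
  "(\<Sum>k\<in>{0..l}. c k * (if k = 0 then theta_E l else phi_B l k) f)
    = c 0 * theta_E l f + (\<Sum>j\<in>{1..l}. c j * phi_B l j f)"
  by (simp add: sum.atLeast_Suc_atMost)

lemma shi_derivations_independent:
  assumes zero: "\<And>f. f \<in> PolS l \<Longrightarrow> c 0 * theta_E l f + (\<Sum>j\<in>{1..l}. c j * phi_B l j f) = 0"
    and k: "k \<in> {0..l}"
  shows "c k = 0"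
proof -
  have "c 0 * Zv = 0"
    using zero[OF PolS_Var[of 0]] by (simp add: theta_E_Var phi_B_Zv)
  moreover have "Zv \<noteq> 0" by (rule nonzero_if_lin_coeff[of 0]) simp
  ultimately have c0: "c 0 = 0" by simp
  show ?thesis
  proof (cases "k = 0")
    case False
    then have k: "k \<in> {1..l}" using k by simp
    have "(- 1) ^ k * c k = 0"
    proof (rule shi_fun_independent[OF _ k])
      fix i assume i: "i \<in> {1..l}"
      then have "Var i \<in> PolS l" by (intro PolS_Var) simp
      then show "(\<Sum>j\<in>{1..l}. ((- 1) ^ j * c j) * shi_fun l j (Var i)) = 0"
        using zero[of "Var i"] i by (simp add: c0 phi_B_Var mult_ac)
    qed
    then show ?thesis by simp
  qed (simp add: c0)
qed

lemma shi_derivations_span: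
  assumes "\<theta> \<in> D_Shi_B l"
  shows "\<exists>c. (\<forall>k\<in>{0..l}. c k \<in> PolS l)
    \<and> (\<forall>f\<in>PolS l. \<theta> f = c 0 * theta_E l f + (\<Sum>j\<in>{1..l}. c j * phi_B l j f))"
proof -
  have der: "\<theta> \<in> Der l" using assms by (simp add: D_Shi_B_def)
  obtain q where q: "q \<in> PolS l" "\<theta> Zv = Zv * q" "shi_vector l (\<lambda>i. \<theta> (Var i) - q * Var i)"
    using D_Shi_B_reduce[OF assms] .
  from shi_vector_spanned[OF q(3)] obtain w where w: "\<And>j. j \<in> {1..l} \<Longrightarrow> w j \<in> PolS l"
    "\<And>i. i \<in> {1..l} \<Longrightarrow> \<theta> (Var i) - q * Var i = (\<Sum>j\<in>{1..l}. w j * shi_fun l j (Var i))" by blast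
  define c where "c = (\<lambda>k. if k = 0 then q else (- 1) ^ k * w k)"
  have var: "\<theta> (Var i) = c 0 * theta_E l (Var i) + (\<Sum>j\<in>{1..l}. c j * phi_B l j (Var i))"
    if i: "i \<in> {0..l}" for i
  proof (cases "i = 0")
    case True
    then show ?thesis using q(2) by (simp add: theta_E_Var phi_B_Zv c_def mult.commute)
  next
    case False
    then have i: "i \<in> {1..l}" using i by simp
    have "c j * phi_B l j (Var i) = w j * shi_fun l j (Var i)" if "j \<in> {1..l}" for j
    proof -
      have "c j * phi_B l j (Var i) = ((- 1) ^ j * (- 1) ^ j) * (w j * shi_fun l j (Var i))"
        using that unfolding phi_B_Var[OF i] c_def by (simp add: mult_ac)
      then show ?thesis by (simp flip: power_mult_distrib)
    qed
    then have "(\<Sum>j\<in>{1..l}. c j * phi_B l j (Var i)) = \<theta> (Var i) - q * Var i"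
      unfolding w(2)[OF i] by (intro sum.cong) auto
    then show ?thesis using i by (simp add: theta_E_Var c_def)
  qed
  have "\<theta> f = c 0 * theta_E l f + (\<Sum>j\<in>{1..l}. c j * phi_B l j f)" if f: "f \<in> PolS l" for f
  proof -
    have "\<theta> f = (\<Sum>i\<in>{0..l}. \<theta> (Var i) * pd i f)"
      using Der_eq_deriv_of[OF der f] by (simp add: deriv_of_def)
    also have "\<dots> = (\<Sum>i\<in>{0..l}. c 0 * (theta_E l (Var i) * pd i f)
        + (\<Sum>j\<in>{1..l}. c j * (phi_B l j (Var i) * pd i f)))"
      by (intro sum.cong refl) (simp only: var distrib_right sum_distrib_right mult.assoc)
    also have "\<dots> = c 0 * (\<Sum>i\<in>{0..l}. theta_E l (Var i) * pd i f)
        + (\<Sum>j\<in>{1..l}. c j * (\<Sum>i\<in>{0..l}. phi_B l j (Var i) * pd i f))"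
      unfolding sum.distrib sum_distrib_left by (subst sum.swap) (rule refl)
    also have "(\<Sum>i\<in>{0..l}. theta_E l (Var i) * pd i f) = theta_E l f"
      using Der_eq_deriv_of[of "theta_E l" l f] theta_E_in_D_Shi_B f
      by (simp add: D_Shi_B_def deriv_of_def)
    also have "(\<Sum>j\<in>{1..l}. c j * (\<Sum>i\<in>{0..l}. phi_B l j (Var i) * pd i f))
        = (\<Sum>j\<in>{1..l}. c j * phi_B l j f)"
      using Der_eq_deriv_of[of "phi_B l _" l f] phi_B_in_D_Shi_B f
      by (intro sum.cong) (simp_all add: D_Shi_B_def deriv_of_def)
    finally show ?thesis .
  qed
  moreover have "c k \<in> PolS l" if "k \<in> {0..l}" for k
    using that q(1) w(1)[of k] by (auto simp: c_def intro!: PolS_mult PolS_power PolS_uminus)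
  ultimately show ?thesis by blast
qed

theorem theorem3p3:
  fixes l :: nat
  assumes "l \<ge> 1"
  shows "theta_E l \<in> D_Shi_B l \<and> (\<forall>j \<in> {1..l}. phi_B l j \<in> D_Shi_B l)
    \<and> is_basis l {0..l} (\<lambda>k. if k = 0 then theta_E l else phi_B l k) (D_Shi_B l)"
proof -
  have mem: "theta_E l \<in> D_Shi_B l" "\<forall>j \<in> {1..l}. phi_B l j \<in> D_Shi_B l"
    using theta_E_in_D_Shi_B phi_B_in_D_Shi_B by auto
  moreover have "is_basis l {0..l} (\<lambda>k. if k = 0 then theta_E l else phi_B l k) (D_Shi_B l)"
    unfolding is_basis_def shi_basis_sum
  proof (intro conjI ballI allI impI)
    fix k assume "k \<in> {0..l}"
    then show "(if k = 0 then theta_E l else phi_B l k) \<in> D_Shi_B l"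
      using mem by simp
  next
    fix \<theta> assume "\<theta> \<in> D_Shi_B l"
    then show "\<exists>c. (\<forall>k\<in>{0..l}. c k \<in> PolS l)
        \<and> (\<forall>f\<in>PolS l. \<theta> f = c 0 * theta_E l f + (\<Sum>j\<in>{1..l}. c j * phi_B l j f))"
      by (rule shi_derivations_span)
  next
    fix c k
    assume "(\<forall>k\<in>{0..l}. c k \<in> PolS l)
      \<and> (\<forall>f\<in>PolS l. c 0 * theta_E l f + (\<Sum>j\<in>{1..l}. c j * phi_B l j f) = 0)" and "k \<in> {0..l}"
    then show "c k = 0"
      by (intro shi_derivations_independent[of l c k]) auto
  qed
  ultimately show ?thesis by blast
qed

end
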